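(* Let $\beta_0,\beta_1\in\mathbb{R}$ and let $X,Y,U$ be real random variables with $Y\mid X\sim Po(\exp(\beta_0+\beta_1X))$. Let $W=X+U$ and assume that $U$ is independent of $(X,Y)$. Let $(Y_i,X_i,U_i)$, $i=1,\dots,n$, be i.i.d. samples of $(Y,X,U)$, let $W_i=X_i+U_i$, let $\hat{\boldsymbol\beta}^{(N)}=(\hat\beta_0^{(N)},\hat\beta_1^{(N)})'$ be the naïve estimator based on $(Y_i,W_i)_{i=1}^n$, and let $\boldsymbol b=(b_0,b_1)'$ be its limit in probability, i.e. the solution of the limiting estimating equation (both as defined in the context). Assume that $M_X(\beta_1)$, $M_X(b_1)$, $M_U(b_1)$ exist. Let $$G(\beta_1,b_1):=K_W'(b_1)-\mathbf{E}[U]-K_X'(\beta_1).$$ Assume that $G$ has a zero in $\mathbb{R}^2$ and satisfies $$\frac{\partial G(\beta_1,b_1)}{\partial \beta_1}=-K_X''(\beta_1)\neq 0.$$ Then the corrected naïve estimator $\hat{\boldsymbol\beta}^{(CN)}=(\hat\beta_0^{(CN)},\hat\beta_1^{(CN)})'$ (defined in the context), which corrects the bias of the naïve estimator $\hat{\boldsymbol\beta}^{(N)}$, is given by $$\hat\beta_0^{(CN)}=\hat\beta_0^{(N)}+\log\left(\frac{M_W(\hat\beta_1^{(N)})}{M_X(\hat\beta_1^{(CN)})}\right),\qquad \hat\beta_1^{(CN)}=h(\hat\beta_1^{(N)}),$$ where $h$ is a $C^1$-class function satisfying $\beta_1=h(b_1)$ in the neighborhood of the zero of $G$. Furthermore,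 the corrected naïve estimator is a consistent estimator of $\boldsymbol\beta=(\beta_0,\beta_1)'$, i.e. $\hat{\boldsymbol\beta}^{(CN)}\overset{p}{\longrightarrow}\boldsymbol\beta$ as $n\to\infty$.
   Context: $Po(\mu)$ is the Poisson distribution with mean $\mu$. For a random variable $Z$, $M_Z(t)=\mathbf{E}[e^{tZ}]$ is its moment generating function and $K_Z(t)=\log M_Z(t)$ its cumulant generating function; primes on $K_Z$ denote derivatives, while a prime on a vector denotes transpose. "Existence" of $M_Z(t)$ means that the expectation exists (is finite); it is assumed in order that the expectations $\mathbf{E}[Y]$, $\mathbf{E}[YW]$, $\mathbf{E}[\exp(b_0+b_1W)]$, $\mathbf{E}[W\exp(b_0+b_1W)]$ exist. $\overset{p}{\longrightarrow}$ denotes convergence in probability. Only $Y_i$ and $W_i$ are observed; $X_i$ (explanatory variable) and $U_i$ (measurement error) are not. The mean and variance of $U$ are assumed known. The naïve estimator $\hat{\boldsymbol\beta}^{(N)}=(\hat\beta_0^{(N)},\hat\beta_1^{(N)})'$ of $\boldsymbol\beta$ is the solution of $$\frac1n\sum_{i=1}^n\{Y_i-\exp(\hat\beta_0^{(N)}+\hat\beta_1^{(N)}W_i)\}(1,W_i)'=(0,0)'.$$ The vector $\boldsymbol b=(b_0,b_1)'$ to which the naïve estimator converges in probability as $n\to\infty$ is the solution of $$\mathbf{E}[\{Y-\exp(b_0+b_1W)\}(1,W)']=(0,0)'.$$ The corrected naïve estimator $\hat{\boldsymbol\beta}^{(CN)}$ is the estimator obtained by solving the system $$\beta_0=b_0+\log\left(\frac{M_W(b_1)}{M_X(\beta_1)}\right),\qquad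 K_W'(b_1)-\mathbf{E}[U]-K_X'(\beta_1)=0$$ for $(\beta_0,\beta_1)$ in terms of $(b_0,b_1)$ and then replacing $(b_0,b_1)$ by $(\hat\beta_0^{(N)},\hat\beta_1^{(N)})$. In the definition of $G$ and in $\beta_1=h(b_1)$, the symbols $\beta_1,b_1$ are also used as the variables of $G$; the function $h$ is the implicit function determined by $G(h(b_1),b_1)=0$ near the zero of $G$. *)

theory Defs
  imports "HOL-Probability.Probability"
begin

definition mgf :: "'a measure \<Rightarrow> ('a \<Rightarrow> real) \<Rightarrow> real \<Rightarrow> real" where
  "mgf M Z t = (\<integral>\<omega>. exp (t * Z \<omega>) \<partial>M)"

definition cgf :: "'a measure \<Rightarrow> ('a \<Rightarrow> real) \<Rightarrow> real \<Rightarrow> real" where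
  "cgf M Z t = ln (mgf M Z t)"

text \<open>The moment generating function is required to be finite on a neighbourhood of \<open>t\<close> and not
  only at \<open>t\<close>. Otherwise the derivatives of \<open>cgf M Z\<close> at \<open>t\<close> are meaningless: \<open>integral\<close> is \<open>0\<close> for a
  non-integrable function, and \<open>deriv\<close> is an arbitrary value where there is no derivative.
  The neighbourhood is also what makes expectations such as \<open>E[Z exp (t Z)]\<close> exist.\<close>

definition mgf_exists :: "'a measure \<Rightarrow> ('a \<Rightarrow> real) \<Rightarrow> real \<Rightarrow> bool" where
  "mgf_exists M Z t \<longleftrightarrow> t \<in> interior {s. integrable M (\<lambda>\<omega>. exp (s * Z \<omega>))}"

text \<open>The conditional law of \<open>Y\<close> given \<open>X\<close> is \<open>Po(exp(\<beta>0 + \<beta>1 X))\<close>: a version of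
  \<open>P(Y \<in> B | \<sigma>(X))\<close> is the mass given to \<open>B\<close> by this Poisson distribution, seen as a distribution on
  the reals.\<close>

definition poisson_regression ::
  "'a measure \<Rightarrow> ('a \<Rightarrow> real) \<Rightarrow> ('a \<Rightarrow> real) \<Rightarrow> real \<times> real \<Rightarrow> bool" where
  "poisson_regression M X Y \<beta> \<longleftrightarrow>
     (\<forall>B\<in>sets borel. AE \<omega> in M.
        real_cond_exp M (vimage_algebra (space M) X borel) (indicator (Y -` B \<inter> space M)) \<omega> =
        measure_pmf.prob (map_pmf real (poisson_pmf (exp (fst \<beta> + snd \<beta> * X \<omega>)))) B)"

text \<open>\<open>y\<close> and \<open>w\<close> are the observed values, with the sample indexed by \<open>{..<n}\<close>.\<close>

definition naive_equation ::
  "nat \<Rightarrow> (nat \<Rightarrow> real) \<Rightarrow> (nat \<Rightarrow> real) \<Rightarrow> real \<times> real \<Rightarrow> bool" where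
  "naive_equation n y w c \<longleftrightarrow>
     (1 / real n) *\<^sub>R (\<Sum>i<n. (y i - exp (fst c + snd c * w i)) *\<^sub>R (1, w i)) = (0 :: real \<times> real)"

text \<open>The estimating equation has no solution on some samples (for instance if all \<open>y i\<close> are \<open>0\<close>,
  which has positive probability). A naive estimator is a sequence of random vectors that solve the
  equation on every sample for which it is solvable; its other values are unconstrained.\<close>

definition naive_estimator ::
  "'a measure \<Rightarrow> (nat \<Rightarrow> 'a \<Rightarrow> real) \<Rightarrow> (nat \<Rightarrow> 'a \<Rightarrow> real) \<Rightarrow> (nat \<Rightarrow> 'a \<Rightarrow> real \<times> real) \<Rightarrow> bool" where
  "naive_estimator M Ys Ws \<beta>N \<longleftrightarrow>
     (\<forall>n. \<beta>N n \<in> borel_measurable M) \<and>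
     (\<forall>n. \<forall>\<omega>\<in>space M.
        (\<exists>c. naive_equation n (\<lambda>i. Ys i \<omega>) (\<lambda>i. Ws i \<omega>) c) \<longrightarrow>
        naive_equation n (\<lambda>i. Ys i \<omega>) (\<lambda>i. Ws i \<omega>) (\<beta>N n \<omega>))"

definition limiting_equation ::
  "'a measure \<Rightarrow> ('a \<Rightarrow> real) \<Rightarrow> ('a \<Rightarrow> real) \<Rightarrow> real \<times> real \<Rightarrow> bool" where
  "limiting_equation M Y W b \<longleftrightarrow>
     has_bochner_integral M
       (\<lambda>\<omega>. (Y \<omega> - exp (fst b + snd b * W \<omega>)) *\<^sub>R (1, W \<omega>)) (0 :: real \<times> real)"

definition G_fun ::
  "'a measure \<Rightarrow> ('a \<Rightarrow> real) \<Rightarrow> ('a \<Rightarrow> real) \<Rightarrow> real \<Rightarrow> real \<Rightarrow> real" where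
  "G_fun M X U s t =
     deriv (cgf M (\<lambda>\<omega>. X \<omega> + U \<omega>)) t - (\<integral>\<omega>. U \<omega> \<partial>M) - deriv (cgf M X) s"

definition correction_system ::
  "'a measure \<Rightarrow> ('a \<Rightarrow> real) \<Rightarrow> ('a \<Rightarrow> real) \<Rightarrow> real \<times> real \<Rightarrow> real \<times> real \<Rightarrow> bool" where
  "correction_system M X U b \<beta> \<longleftrightarrow>
     mgf_exists M (\<lambda>\<omega>. X \<omega> + U \<omega>) (snd b) \<and> mgf_exists M X (snd \<beta>) \<and>
     fst \<beta> = fst b + ln (mgf M (\<lambda>\<omega>. X \<omega> + U \<omega>) (snd b) / mgf M X (snd \<beta>)) \<and>
     G_fun M X U (snd \<beta>) (snd b) = 0"

text \<open>The solution of the correction system as a function of \<open>b\<close>. If \<open>X\<close> is not almost surely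
  constant then \<open>deriv (cgf M X)\<close> is strictly increasing where \<open>mgf_exists M X\<close> holds, so there is at
  most one solution; the value is irrelevant if there is none.\<close>

definition corrected :: "'a measure \<Rightarrow> ('a \<Rightarrow> real) \<Rightarrow> ('a \<Rightarrow> real) \<Rightarrow> real \<times> real \<Rightarrow> real \<times> real" where
  "corrected M X U b = (THE \<beta>. correction_system M X U b \<beta>)"

definition converges_in_probability ::
  "'a measure \<Rightarrow> (nat \<Rightarrow> 'a \<Rightarrow> 'b::{second_countable_topology, metric_space}) \<Rightarrow> 'b \<Rightarrow> bool" where
  "converges_in_probability M Z c \<longleftrightarrow>
     (\<forall>n. Z n \<in> borel_measurable M) \<and>
     (\<forall>\<epsilon>>0. (\<lambda>n. measure M {\<omega>\<in>space M. dist (Z n \<omega>) c \<ge> \<epsilon>}) \<longlonglongrightarrow> 0)"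

end

theory Submission
  imports Defs
begin

text \<open>
  The naive estimator converges to \<^term>\<open>b\<close>, the correction map is continuous at \<^term>\<open>b\<close>, and it
  sends \<^term>\<open>b\<close> to the true parameter. These three facts give consistency.

  \<^bold>\<open>The correction map.\<close> Tilting the law of \<^term>\<open>X\<close> by \<open>exp (s X)\<close> turns \<open>K_X'(s)\<close> into a mean and
  \<open>K_X''(s)\<close> into a variance. The variance vanishes for one \<^term>\<open>s\<close> only if \<^term>\<open>X\<close> is almost surely
  constant, and then it vanishes for all \<^term>\<open>s\<close>. So \<open>K_X''(\<beta>1) \<noteq> 0\<close> at a single point already makes
  \<open>K_X'\<close> strictly increasing on the whole interior of the interval where \<open>M_X\<close> is finite. Its inverse
  is \<open>C\<^sup>1\<close>, and \<open>h(t) = (K_X')\<^sup>-\<^sup>1(K_W'(t) - E U)\<close> is the global solution of \<open>G(h(t), t) = 0\<close>, defined on an open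
  set of slopes. On that set the correction system has exactly one solution, continuous in \<^term>\<open>b\<close>.
  Off the set it has none, and the corrected estimator takes one fixed value. This description,
  \<open>corrected_eq\<close>, gives both the formula for the corrected estimator and its measurability.

  \<^bold>\<open>Identification.\<close> Conditioning on \<^term>\<open>X\<close> gives \<open>E Y = exp \<beta>0 M_X(\<beta>1)\<close> and
  \<open>E (X Y) = exp \<beta>0 M_X'(\<beta>1)\<close>, and independence gives \<open>E (U Y) = E U E Y\<close>. The limiting equation says
  that \<open>E Y = exp b0 M_W(b1)\<close> and \<open>E (W Y) = exp b0 M_W'(b1)\<close>. The ratio of the two moments is
  \<open>K_X'(\<beta>1) + E U = K_W'(b1)\<close>, and the first moment gives the intercept
  (\<open>poisson_regression_identification\<close>).

  \<^bold>\<open>Consistency of the naive estimator.\<close> Solutions of the naive equation are the minimisers of a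
  convex function, the negative Poisson log-likelihood. Its increase from \<^term>\<open>b\<close> to \<open>b + v\<close> is bounded
  below by a random quadratic form in \<^term>\<open>v\<close> minus \<^term>\<open>v\<close> times the score at \<^term>\<open>b\<close>. By the weak law
  of large numbers the form is close to a positive definite one and the score is close to \<open>0\<close>, so
  with probability tending to \<open>1\<close> the function is larger on a small sphere around \<^term>\<open>b\<close> than at
  \<^term>\<open>b\<close>. Convexity then puts a solution inside the sphere and none outside it
  (\<open>naive_equation_solution_near\<close>, \<open>naive_estimator_consistent\<close>). Since only five
  scalar averages are involved, neither a uniform law of large numbers nor second moments of
  \<open>exp (b1 W)\<close> are called for. Positive definiteness is the statement that \<^term>\<open>W\<close> is not almost surely
  constant, which holds because \<open>K_W'' = K_X'' + K_U''\<close> is positive at \<open>b1\<close>.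
\<close>

section \<open>Exponential moments and tilted cumulants\<close>

definition exp_moment :: "'a measure \<Rightarrow> ('a \<Rightarrow> real) \<Rightarrow> nat \<Rightarrow> real \<Rightarrow> real" where
  "exp_moment M Z k t = (\<integral>\<omega>. Z \<omega> ^ k * exp (t * Z \<omega>) \<partial>M)"

lemma exp_moment_0: "exp_moment M Z 0 = mgf M Z"
  by (simp add: exp_moment_def mgf_def fun_eq_iff)

lemma power_le_fact_mult_exp:
  fixes x :: real
  assumes "0 \<le> x"
  shows "x ^ k \<le> fact k * exp x"
proof -
  have "(\<Sum>n\<in>{k}. x ^ n /\<^sub>R fact n) \<le> (\<Sum>n. x ^ n /\<^sub>R fact n)"
    using assms by (intro sum_le_suminf summable_exp_generic) auto
  then have "x ^ k /\<^sub>R fact k \<le> exp x"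
    by (simp add: exp_def)
  then show ?thesis
    by (simp add: field_simps)
qed

lemma abs_exp_minus_affine_le:
  fixes x :: real
  shows "\<bar>exp x - 1 - x\<bar> \<le> x\<^sup>2 * exp \<bar>x\<bar>"
proof -
  obtain t where t: "\<bar>t\<bar> \<le> \<bar>x\<bar>" "exp x = (\<Sum>m<2. x ^ m / fact m) + exp t / fact 2 * x ^ 2"
    using Maclaurin_exp_le[of x 2] by blast
  then have "exp x - 1 - x = exp t / 2 * x\<^sup>2"
    by (simp add: numeral_2_eq_2)
  then have "\<bar>exp x - 1 - x\<bar> = exp t / 2 * x\<^sup>2" by (simp only: abs_mult) simp
  also have "\<dots> \<le> exp \<bar>x\<bar> * x\<^sup>2"
  proof (rule mult_right_mono)
    have "exp t \<le> exp \<bar>x\<bar>" using t(1) by simp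
    moreover have "0 < exp t" by simp
    ultimately show "exp t / 2 \<le> exp \<bar>x\<bar>" by linarith
  qed simp
  finally show ?thesis by (simp add: mult.commute)
qed

lemma open_mgf_exists: "open {t. mgf_exists M Z t}"
  by (simp add: mgf_exists_def)

lemma mgf_exists_imp_integrable: "mgf_exists M Z t \<Longrightarrow> integrable M (\<lambda>\<omega>. exp (t * Z \<omega>))"
  using interior_subset unfolding mgf_exists_def by blast

text \<open>Because \<open>exp (t z) \<le> exp (a z) + exp (b z)\<close> whatever the sign of \<open>z\<close>; this is why the
  domain of a moment generating function is an interval.\<close>

lemma integrable_exp_between:
  fixes Z :: "'a \<Rightarrow> real"
  assumes [measurable]: "Z \<in> borel_measurable M"
    and "integrable M (\<lambda>\<omega>. exp (a * Z \<omega>))" "integrable M (\<lambda>\<omega>. exp (b * Z \<omega>))" "a \<le> t" "t \<le> b"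
  shows "integrable M (\<lambda>\<omega>. exp (t * Z \<omega>))"
proof (rule Bochner_Integration.integrable_bound)
  show "integrable M (\<lambda>\<omega>. exp (a * Z \<omega>) + exp (b * Z \<omega>))" using assms by simp
  have "exp (t * z) \<le> exp (a * z) + exp (b * z)" for z
  proof (cases "0 \<le> z")
    case True
    then have "exp (t * z) \<le> exp (b * z)" using assms(5) by (simp add: mult_right_mono)
    then show ?thesis using exp_ge_zero[of "a * z"] by linarith
  next
    case False
    then have "exp (t * z) \<le> exp (a * z)" using assms(4) by (simp add: mult_right_mono_neg)
    then show ?thesis using exp_ge_zero[of "b * z"] by linarith
  qed
  then show "AE \<omega> in M. norm (exp (t * Z \<omega>)) \<le> norm (exp (a * Z \<omega>) + exp (b * Z \<omega>))"
    by (auto intro!: AE_I2 order_trans[OF _ abs_ge_self])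
qed simp

lemma convex_mgf_exists:
  assumes [measurable]: "Z \<in> borel_measurable M"
  shows "convex {t. mgf_exists M Z t}"
proof -
  have "is_interval {s. integrable M (\<lambda>\<omega>. exp (s * Z \<omega>))}"
    unfolding is_interval_1 using integrable_exp_between[OF assms] by blast
  then show ?thesis
    by (simp add: mgf_exists_def convex_interior is_interval_convex)
qed

text \<open>The room around an interior point absorbs any polynomial factor: with \<open>2 \<delta>\<close> of room, one \<open>\<delta>\<close> pays for
  \<open>\<bar>z\<bar> ^ k\<close> through \<open>power_le_fact_mult_exp\<close>, and the other is left over in the exponent. That remainder
  dominates difference quotients in \<open>t\<close>.\<close>

lemma mgf_exists_absolute_moments:
  assumes [measurable]: "Z \<in> borel_measurable M" and "mgf_exists M Z t"
  obtains \<delta> where "\<delta> > 0" "\<And>k. integrable M (\<lambda>\<omega>. \<bar>Z \<omega>\<bar> ^ k * exp (t * Z \<omega> + \<delta> * \<bar>Z \<omega>\<bar>))"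
proof -
  obtain e where e: "e > 0" "cball t e \<subseteq> {s. integrable M (\<lambda>\<omega>. exp (s * Z \<omega>))}"
    using assms(2) unfolding mgf_exists_def mem_interior_cball by blast
  define \<delta> where "\<delta> = e / 2"
  have "\<delta> > 0" using e by (simp add: \<delta>_def)
  have 1: "integrable M (\<lambda>\<omega>. exp ((t + e) * Z \<omega>))" "integrable M (\<lambda>\<omega>. exp ((t - e) * Z \<omega>))"
    using e by (auto simp: subset_iff dist_real_def)
  have "integrable M (\<lambda>\<omega>. \<bar>Z \<omega>\<bar> ^ k * exp (t * Z \<omega> + \<delta> * \<bar>Z \<omega>\<bar>))" for k
  proof (rule Bochner_Integration.integrable_bound)
    show "integrable M (\<lambda>\<omega>. fact k / \<delta> ^ k * (exp ((t + e) * Z \<omega>) + exp ((t - e) * Z \<omega>)))"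
      using 1 by simp
    show "AE \<omega> in M. norm (\<bar>Z \<omega>\<bar> ^ k * exp (t * Z \<omega> + \<delta> * \<bar>Z \<omega>\<bar>))
        \<le> norm (fact k / \<delta> ^ k * (exp ((t + e) * Z \<omega>) + exp ((t - e) * Z \<omega>)))"
    proof (rule AE_I2)
      fix \<omega>
      let ?z = "Z \<omega>"
      have "(\<delta> * \<bar>?z\<bar>) ^ k \<le> fact k * exp (\<delta> * \<bar>?z\<bar>)"
        using \<open>\<delta> > 0\<close> by (intro power_le_fact_mult_exp) simp
      then have "\<bar>?z\<bar> ^ k \<le> fact k / \<delta> ^ k * exp (\<delta> * \<bar>?z\<bar>)"
        using \<open>\<delta> > 0\<close> by (simp add: power_mult_distrib field_simps)
      then have "\<bar>?z\<bar> ^ k * exp (t * ?z + \<delta> * \<bar>?z\<bar>)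
          \<le> fact k / \<delta> ^ k * exp (\<delta> * \<bar>?z\<bar>) * exp (t * ?z + \<delta> * \<bar>?z\<bar>)"
        by (intro mult_right_mono) auto
      also have "\<dots> = fact k / \<delta> ^ k * exp (t * ?z + e * \<bar>?z\<bar>)"
        by (simp add: exp_add[symmetric] \<delta>_def algebra_simps)
      also have "\<dots> \<le> fact k / \<delta> ^ k * (exp ((t + e) * ?z) + exp ((t - e) * ?z))"
        using \<open>\<delta> > 0\<close> by (intro mult_left_mono) (auto simp: abs_if algebra_simps)
      finally show "norm (\<bar>?z\<bar> ^ k * exp (t * ?z + \<delta> * \<bar>?z\<bar>))
        \<le> norm (fact k / \<delta> ^ k * (exp ((t + e) * ?z) + exp ((t - e) * ?z)))"
        using \<open>\<delta> > 0\<close> by (simp add: abs_mult)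
    qed
  qed simp
  then show ?thesis using \<open>\<delta> > 0\<close> that by blast
qed

lemma mgf_exists_integrable_moment:
  assumes [measurable]: "Z \<in> borel_measurable M" and "mgf_exists M Z t"
  shows "integrable M (\<lambda>\<omega>. Z \<omega> ^ k * exp (t * Z \<omega>))"
proof -
  obtain \<delta> where "\<delta> > 0" and i: "integrable M (\<lambda>\<omega>. \<bar>Z \<omega>\<bar> ^ k * exp (t * Z \<omega> + \<delta> * \<bar>Z \<omega>\<bar>))"
    using mgf_exists_absolute_moments[OF assms] by metis
  show ?thesis
  proof (rule Bochner_Integration.integrable_bound[OF i])
    show "AE \<omega> in M. norm (Z \<omega> ^ k * exp (t * Z \<omega>)) \<le> norm (\<bar>Z \<omega>\<bar> ^ k * exp (t * Z \<omega> + \<delta> * \<bar>Z \<omega>\<bar>))"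
      using \<open>\<delta> > 0\<close> by (auto simp: abs_mult power_abs intro!: AE_I2 mult_left_mono)
  qed simp
qed

text \<open>Differentiation under the integral. The second-order remainder \<open>exp (h z) - 1 - h z\<close> is at most
  \<open>(h z)\<^sup>2 exp \<bar>h z\<bar>\<close>, whose integral against \<open>\<bar>z\<bar> ^ k exp (t z)\<close> is \<open>O(h\<^sup>2)\<close>, so no limit theorem for
  integrals is involved.\<close>

lemma has_real_derivative_exp_moment:
  assumes [measurable]: "Z \<in> borel_measurable M" and "mgf_exists M Z t"
  shows "(exp_moment M Z k has_real_derivative exp_moment M Z (Suc k) t) (at t)"
proof -
  obtain \<delta> where \<delta>: "\<delta> > 0"
    and i: "integrable M (\<lambda>\<omega>. \<bar>Z \<omega>\<bar> ^ (k + 2) * exp (t * Z \<omega> + \<delta> * \<bar>Z \<omega>\<bar>))"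
    using mgf_exists_absolute_moments[OF assms] by metis
  define C where "C = (\<integral>\<omega>. \<bar>Z \<omega>\<bar> ^ (k + 2) * exp (t * Z \<omega> + \<delta> * \<bar>Z \<omega>\<bar>) \<partial>M)"
  let ?F = "exp_moment M Z"
  have "eventually (\<lambda>h. mgf_exists M Z (t + h)) (at 0)"
  proof -
    have "((\<lambda>h. t + h) \<longlongrightarrow> t + 0) (at 0)" by (intro tendsto_intros)
    then show ?thesis
      using topological_tendstoD[OF _ open_mgf_exists] assms(2) by fastforce
  qed
  moreover have "eventually (\<lambda>h. h \<noteq> 0 \<and> \<bar>h\<bar> < \<delta>) (at (0::real))"
    unfolding eventually_at using \<delta> by (auto simp: dist_real_def)
  ultimately have bound:
    "eventually (\<lambda>h. norm ((?F k (t + h) - ?F k t) / h - ?F (Suc k) t) \<le> \<bar>h\<bar> * C) (at 0)"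
  proof eventually_elim
    case (elim h)
    note int = mgf_exists_integrable_moment[OF assms(1)]
    define R where "R \<omega> = Z \<omega> ^ k * exp (t * Z \<omega>) * (exp (h * Z \<omega>) - 1 - h * Z \<omega>)" for \<omega>
    have R: "R \<omega> = Z \<omega> ^ k * exp ((t + h) * Z \<omega>) - Z \<omega> ^ k * exp (t * Z \<omega>)
        - h * (Z \<omega> ^ Suc k * exp (t * Z \<omega>))" for \<omega>
      by (simp add: R_def algebra_simps exp_add)
    have "integrable M R"
      unfolding R using elim assms(2)
      by (intro Bochner_Integration.integrable_diff int integrable_mult_right) auto
    have "?F k (t + h) - ?F k t - h * ?F (Suc k) t = (\<integral>\<omega>. R \<omega> \<partial>M)"
    proof -
      have i: "integrable M (\<lambda>\<omega>. Z \<omega> ^ k * exp ((t + h) * Z \<omega>))"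
          "integrable M (\<lambda>\<omega>. Z \<omega> ^ k * exp (t * Z \<omega>))"
          "integrable M (\<lambda>\<omega>. h * (Z \<omega> ^ Suc k * exp (t * Z \<omega>)))"
        using elim assms(2) by (auto intro!: int integrable_mult_right simp del: power_Suc)
      show ?thesis
        unfolding exp_moment_def R
        by (simp only: Bochner_Integration.integral_diff[OF Bochner_Integration.integrable_diff[OF i(1,2)] i(3)]
            Bochner_Integration.integral_diff[OF i(1,2)] integral_mult_right_zero)
    qed
    also have "\<bar>\<dots>\<bar> \<le> (\<integral>\<omega>. h\<^sup>2 * (\<bar>Z \<omega>\<bar> ^ (k + 2) * exp (t * Z \<omega> + \<delta> * \<bar>Z \<omega>\<bar>)) \<partial>M)"
    proof (rule order_trans[OF integral_abs_bound integral_mono])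
      fix \<omega>
      let ?z = "Z \<omega>"
      have "\<bar>R \<omega>\<bar> = \<bar>?z\<bar> ^ k * exp (t * ?z) * \<bar>exp (h * ?z) - 1 - h * ?z\<bar>"
        by (simp add: R_def abs_mult power_abs)
      also have "\<dots> \<le> \<bar>?z\<bar> ^ k * exp (t * ?z) * ((h * ?z)\<^sup>2 * exp \<bar>h * ?z\<bar>)"
        by (intro mult_left_mono abs_exp_minus_affine_le) auto
      also have "\<dots> \<le> \<bar>?z\<bar> ^ k * exp (t * ?z) * ((h * ?z)\<^sup>2 * exp (\<delta> * \<bar>?z\<bar>))"
        using elim by (intro mult_left_mono) (auto simp: abs_mult mult_right_mono)
      also have "\<dots> = h\<^sup>2 * (\<bar>?z\<bar> ^ (k + 2) * exp (t * ?z + \<delta> * \<bar>?z\<bar>))"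
        by (simp add: power_add exp_add power_mult_distrib power2_eq_square)
      finally show "\<bar>R \<omega>\<bar> \<le> h\<^sup>2 * (\<bar>?z\<bar> ^ (k + 2) * exp (t * ?z + \<delta> * \<bar>?z\<bar>))" .
    qed (use \<open>integrable M R\<close> i in auto)
    also have "\<dots> = h\<^sup>2 * C" by (simp add: C_def)
    finally have *: "\<bar>?F k (t + h) - ?F k t - h * ?F (Suc k) t\<bar> \<le> h\<^sup>2 * C" .
    have "norm ((?F k (t + h) - ?F k t) / h - ?F (Suc k) t)
        = \<bar>?F k (t + h) - ?F k t - h * ?F (Suc k) t\<bar> / \<bar>h\<bar>"
      using elim by (simp add: abs_divide[symmetric] diff_divide_distrib)
    also have "\<dots> \<le> h\<^sup>2 * C / \<bar>h\<bar>" using * by (simp add: divide_right_mono)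
    also have "\<dots> = \<bar>h\<bar> * C" using elim by (simp add: power2_eq_square abs_if)
    finally show ?case .
  qed
  have "((\<lambda>h. \<bar>h\<bar> * C) \<longlongrightarrow> \<bar>0\<bar> * C) (at 0)" by (intro tendsto_intros)
  then have "((\<lambda>h. (?F k (t + h) - ?F k t) / h - ?F (Suc k) t) \<longlongrightarrow> 0) (at 0)"
    using Lim_null_comparison[OF bound] by simp
  then show ?thesis
    unfolding DERIV_def by (simp add: LIM_zero_iff)
qed

lemma continuous_on_mgf:
  assumes "Z \<in> borel_measurable M"
  shows "continuous_on {t. mgf_exists M Z t} (mgf M Z)"
  using has_real_derivative_exp_moment[OF assms, of _ 0] unfolding exp_moment_0
  by (intro continuous_at_imp_continuous_on ballI) (blast intro: DERIV_isCont)

context prob_space begin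

lemma mgf_pos:
  assumes "mgf_exists M Z t"
  shows "mgf M Z t > 0"
proof -
  have i: "integrable M (\<lambda>\<omega>. exp (t * Z \<omega>))" by (rule mgf_exists_imp_integrable[OF assms])
  have "mgf M Z t \<noteq> 0"
  proof
    assume "mgf M Z t = 0"
    then have "AE \<omega> in M. exp (t * Z \<omega>) = 0"
      unfolding mgf_def using integral_nonneg_eq_0_iff_AE[OF i] by simp
    then show False by (simp add: AE_False)
  qed
  moreover have "mgf M Z t \<ge> 0" by (simp add: mgf_def)
  ultimately show ?thesis by simp
qed

text \<open>Mean and variance of \<open>Z\<close> under the law with density \<open>exp (t Z) / mgf M Z t\<close>. They are the first
  two derivatives of the cumulant generating function.\<close>

definition tilted_mean :: "('a \<Rightarrow> real) \<Rightarrow> real \<Rightarrow> real" where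
  "tilted_mean Z t = exp_moment M Z 1 t / mgf M Z t"

definition tilted_variance :: "('a \<Rightarrow> real) \<Rightarrow> real \<Rightarrow> real" where
  "tilted_variance Z t = (\<integral>\<omega>. (Z \<omega> - tilted_mean Z t)\<^sup>2 * exp (t * Z \<omega>) \<partial>M) / mgf M Z t"

lemma integrable_tilted_square:
  assumes [measurable]: "Z \<in> borel_measurable M" and "mgf_exists M Z t"
  shows "integrable M (\<lambda>\<omega>. (Z \<omega> - m)\<^sup>2 * exp (t * Z \<omega>))"
proof -
  have "(\<lambda>\<omega>. (Z \<omega> - m)\<^sup>2 * exp (t * Z \<omega>)) = (\<lambda>\<omega>. Z \<omega> ^ 2 * exp (t * Z \<omega>)
     - 2 * m * (Z \<omega> ^ 1 * exp (t * Z \<omega>)) + m\<^sup>2 * (Z \<omega> ^ 0 * exp (t * Z \<omega>)))"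
    by (simp add: fun_eq_iff power2_eq_square algebra_simps)
  then show ?thesis
    by (simp only:) (intro Bochner_Integration.integrable_add Bochner_Integration.integrable_diff
        integrable_mult_right mgf_exists_integrable_moment[OF assms])
qed

lemma tilted_variance_eq:
  assumes [measurable]: "Z \<in> borel_measurable M" and ex: "mgf_exists M Z t"
  shows "tilted_variance Z t = exp_moment M Z 2 t / mgf M Z t - (tilted_mean Z t)\<^sup>2"
proof -
  let ?m = "tilted_mean Z t"
  have "(\<integral>\<omega>. (Z \<omega> - ?m)\<^sup>2 * exp (t * Z \<omega>) \<partial>M) = (\<integral>\<omega>. Z \<omega> ^ 2 * exp (t * Z \<omega>)
     - 2 * ?m * (Z \<omega> ^ 1 * exp (t * Z \<omega>)) + ?m\<^sup>2 * (Z \<omega> ^ 0 * exp (t * Z \<omega>)) \<partial>M)"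
    by (intro Bochner_Integration.integral_cong refl) (simp add: power2_eq_square algebra_simps)
  also have "\<dots> = exp_moment M Z 2 t - 2 * ?m * exp_moment M Z 1 t + ?m\<^sup>2 * exp_moment M Z 0 t"
    unfolding exp_moment_def
    using mgf_exists_integrable_moment[OF assms, of 0] mgf_exists_integrable_moment[OF assms, of 1]
      mgf_exists_integrable_moment[OF assms, of 2]
    by simp
  finally have *: "(\<integral>\<omega>. (Z \<omega> - ?m)\<^sup>2 * exp (t * Z \<omega>) \<partial>M)
    = exp_moment M Z 2 t - 2 * ?m * exp_moment M Z 1 t + ?m\<^sup>2 * exp_moment M Z 0 t" .
  have "exp_moment M Z 1 t = ?m * mgf M Z t"
    using mgf_pos[OF ex] by (simp add: tilted_mean_def)
  then show ?thesis
    using mgf_pos[OF ex]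
    by (subst tilted_variance_def, subst *, simp add: exp_moment_0 field_simps power2_eq_square)
qed

lemma has_real_derivative_cgf:
  assumes [measurable]: "Z \<in> borel_measurable M" and "mgf_exists M Z t"
  shows "(cgf M Z has_real_derivative tilted_mean Z t) (at t)"
proof -
  have "(mgf M Z has_real_derivative exp_moment M Z 1 t) (at t)"
    using has_real_derivative_exp_moment[OF assms, of 0] by (simp add: exp_moment_0)
  then have "((\<lambda>t. ln (mgf M Z t)) has_real_derivative tilted_mean Z t) (at t)"
    using mgf_pos[OF assms(2)] by (auto intro!: derivative_eq_intros simp: tilted_mean_def)
  then show ?thesis by (simp add: cgf_def[abs_def])
qed

lemma deriv_cgf:
  assumes "Z \<in> borel_measurable M" "mgf_exists M Z t"
  shows "deriv (cgf M Z) t = tilted_mean Z t"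
  using has_real_derivative_cgf[OF assms] by (rule DERIV_imp_deriv)

lemma has_real_derivative_tilted_mean:
  assumes [measurable]: "Z \<in> borel_measurable M" and "mgf_exists M Z t"
  shows "(tilted_mean Z has_real_derivative tilted_variance Z t) (at t)"
proof -
  have 0: "(mgf M Z has_real_derivative exp_moment M Z 1 t) (at t)"
    and 1: "(exp_moment M Z 1 has_real_derivative exp_moment M Z 2 t) (at t)"
    using has_real_derivative_exp_moment[OF assms, of 0] has_real_derivative_exp_moment[OF assms, of 1]
    by (simp_all add: exp_moment_0 numeral_2_eq_2)
  have "((\<lambda>t. exp_moment M Z 1 t / mgf M Z t) has_real_derivative tilted_variance Z t) (at t)"
    using mgf_pos[OF assms(2)]
    by (auto intro!: derivative_eq_intros 0 1
        simp: 0 1[simplified] tilted_variance_eq[OF assms] tilted_mean_def field_simps power2_eq_square)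
  then show ?thesis by (simp add: tilted_mean_def[abs_def])
qed

lemma continuous_on_tilted_mean:
  assumes "Z \<in> borel_measurable M"
  shows "continuous_on {t. mgf_exists M Z t} (tilted_mean Z)"
  using has_real_derivative_tilted_mean[OF assms]
  by (intro continuous_at_imp_continuous_on ballI) (blast intro: DERIV_isCont)

lemma has_real_derivative_deriv_cgf:
  assumes [measurable]: "Z \<in> borel_measurable M" and "mgf_exists M Z t"
  shows "(deriv (cgf M Z) has_real_derivative tilted_variance Z t) (at t)"
  using has_real_derivative_tilted_mean[OF assms] open_mgf_exists[of M Z]
  by (rule has_field_derivative_transform_within_open) (use assms in \<open>auto simp: deriv_cgf\<close>)

lemma continuous_on_tilted_variance:
  assumes [measurable]: "Z \<in> borel_measurable M"
  shows "continuous_on {t. mgf_exists M Z t} (tilted_variance Z)"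
proof -
  have "continuous_on {t. mgf_exists M Z t} (exp_moment M Z k)" for k
    using has_real_derivative_exp_moment[OF assms]
    by (intro continuous_at_imp_continuous_on ballI) (blast intro: DERIV_isCont)
  moreover have "mgf M Z t \<noteq> 0" if "mgf_exists M Z t" for t
    using mgf_pos[OF that] by simp
  ultimately have "continuous_on {t. mgf_exists M Z t}
      (\<lambda>t. exp_moment M Z 2 t / exp_moment M Z 0 t - (exp_moment M Z 1 t / exp_moment M Z 0 t)\<^sup>2)"
    by (intro continuous_intros) (auto simp: exp_moment_0[symmetric])
  then show ?thesis
    by (rule continuous_on_eq) (simp add: tilted_variance_eq exp_moment_0 tilted_mean_def)
qed

lemma tilted_variance_nonneg: "tilted_variance Z t \<ge> 0"
  by (simp add: tilted_variance_def mgf_def)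

text \<open>The tilted law and \<open>M\<close> have the same null sets, so the condition on the right does not
  depend on \<open>t\<close>: the second cumulant vanishes everywhere or nowhere.\<close>

lemma tilted_variance_eq_0_iff:
  assumes [measurable]: "Z \<in> borel_measurable M" and ex: "mgf_exists M Z t"
  shows "tilted_variance Z t = 0 \<longleftrightarrow> (\<exists>c. AE \<omega> in M. Z \<omega> = c)"
proof
  assume "tilted_variance Z t = 0"
  then have "(\<integral>\<omega>. (Z \<omega> - tilted_mean Z t)\<^sup>2 * exp (t * Z \<omega>) \<partial>M) = 0"
    using mgf_pos[OF ex] by (simp add: tilted_variance_def)
  then have "AE \<omega> in M. (Z \<omega> - tilted_mean Z t)\<^sup>2 * exp (t * Z \<omega>) = 0"
    using integral_nonneg_eq_0_iff_AE[OF integrable_tilted_square[OF assms]] by simp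
  then show "\<exists>c. AE \<omega> in M. Z \<omega> = c" by auto
next
  assume "\<exists>c. AE \<omega> in M. Z \<omega> = c"
  then obtain c where c: "AE \<omega> in M. Z \<omega> = c" by blast
  have "exp_moment M Z 1 t = (\<integral>\<omega>. c * exp (t * Z \<omega>) \<partial>M)"
    unfolding exp_moment_def by (rule integral_cong_AE) (use c in auto)
  then have "tilted_mean Z t = c"
    using mgf_pos[OF ex] by (simp add: tilted_mean_def mgf_def)
  moreover have "(\<integral>\<omega>. (Z \<omega> - c)\<^sup>2 * exp (t * Z \<omega>) \<partial>M) = (\<integral>\<omega>. 0 \<partial>M)"
    by (rule integral_cong_AE) (use c in auto)
  ultimately show "tilted_variance Z t = 0" by (simp add: tilted_variance_def)
qed

lemma strict_mono_on_tilted_mean: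
  assumes [measurable]: "Z \<in> borel_measurable M" and "\<not> (\<exists>c. AE \<omega> in M. Z \<omega> = c)"
  shows "strict_mono_on {t. mgf_exists M Z t} (tilted_mean Z)"
proof (rule strict_mono_onI)
  fix r s assume rs: "r \<in> {t. mgf_exists M Z t}" "s \<in> {t. mgf_exists M Z t}" "r < s"
  have "is_interval {t. mgf_exists M Z t}"
    using convex_mgf_exists[OF assms(1)] is_interval_convex_1 by blast
  then have ex: "mgf_exists M Z x" if "r \<le> x" "x \<le> s" for x
    using mem_is_interval_1_I[OF _ rs(1,2) that] by blast
  show "tilted_mean Z r < tilted_mean Z s"
  proof (rule DERIV_pos_imp_increasing[OF \<open>r < s\<close>])
    fix x assume x: "r \<le> x" "x \<le> s"
    have "tilted_variance Z x \<noteq> 0"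
      using tilted_variance_eq_0_iff[OF assms(1) ex[OF x]] assms(2) by blast
    then have "tilted_variance Z x > 0"
      using tilted_variance_nonneg[of Z x] by linarith
    then show "\<exists>y. (tilted_mean Z has_real_derivative y) (at x) \<and> 0 < y"
      using has_real_derivative_tilted_mean[OF assms(1) ex[OF x]] by blast
  qed
qed

end

section \<open>The weak law of large numbers\<close>

context prob_space begin

lemma expectation_truncation_error_tendsto_0:
  fixes Z :: "'a \<Rightarrow> real"
  assumes "integrable M Z"
  shows "(\<lambda>m. expectation (\<lambda>\<omega>. \<bar>Z \<omega> - max (- real m) (min (real m) (Z \<omega>))\<bar>)) \<longlonglongrightarrow> 0"
proof -
  have [measurable]: "Z \<in> borel_measurable M" using assms by simp
  have "(\<lambda>m. expectation (\<lambda>\<omega>. \<bar>Z \<omega> - max (- real m) (min (real m) (Z \<omega>))\<bar>)) \<longlonglongrightarrow> expectation (\<lambda>\<omega>. 0)"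
  proof (rule integral_dominated_convergence[where w = "\<lambda>\<omega>. \<bar>Z \<omega>\<bar>"])
    show "AE \<omega> in M. (\<lambda>m. \<bar>Z \<omega> - max (- real m) (min (real m) (Z \<omega>))\<bar>) \<longlonglongrightarrow> 0"
    proof (rule AE_I2)
      fix \<omega>
      obtain N :: nat where N: "\<bar>Z \<omega>\<bar> \<le> real N" using real_arch_simple by blast
      have "eventually (\<lambda>m. \<bar>Z \<omega> - max (- real m) (min (real m) (Z \<omega>))\<bar> = 0) sequentially"
        using eventually_ge_at_top[of N]
      proof eventually_elim
        case (elim m)
        then have "real N \<le> real m" by simp
        then show ?case using N by (auto simp: max_def min_def)
      qed
      then show "(\<lambda>m. \<bar>Z \<omega> - max (- real m) (min (real m) (Z \<omega>))\<bar>) \<longlonglongrightarrow> 0"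
        by (rule tendsto_eventually)
    qed
    show "AE \<omega> in M. norm \<bar>Z \<omega> - max (- real m) (min (real m) (Z \<omega>))\<bar> \<le> \<bar>Z \<omega>\<bar>" for m
      by (rule AE_I2) (auto simp: max_def min_def)
  qed (use assms in auto)
  then show ?thesis by simp
qed

lemma integral_cong_distr:
  fixes g :: "'b::topological_space \<Rightarrow> real"
  assumes "A \<in> borel_measurable M" "B \<in> borel_measurable M" "distr M borel A = distr M borel B"
    and "g \<in> borel_measurable borel"
  shows "integrable M (\<lambda>\<omega>. g (A \<omega>)) \<longleftrightarrow> integrable M (\<lambda>\<omega>. g (B \<omega>))"
    and "expectation (\<lambda>\<omega>. g (A \<omega>)) = expectation (\<lambda>\<omega>. g (B \<omega>))"
  using assms integrable_distr_eq[of A M borel g] integrable_distr_eq[of B M borel g]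
    integral_distr[of A M borel g] integral_distr[of B M borel g] by auto

text \<open>Only a first moment is assumed, so the variables are truncated at level \<open>m\<close>. The truncated averages
  concentrate by Hoeffding's inequality, and the averages of the truncation errors are small in mean,
  hence in probability by Markov's inequality.\<close>

lemma weak_law_of_large_numbers:
  fixes Z :: "nat \<Rightarrow> 'a \<Rightarrow> real"
  assumes indep: "indep_vars (\<lambda>_. borel) Z UNIV"
    and distr: "\<And>i. distr M borel (Z i) = distr M borel Z0"
    and int: "integrable M Z0" and "\<epsilon> > 0"
  shows "(\<lambda>n. prob {\<omega>\<in>space M. \<epsilon> \<le> \<bar>(\<Sum>i<n. Z i \<omega>) / n - expectation Z0\<bar>}) \<longlonglongrightarrow> 0"
proof (rule LIMSEQ_I)
  fix \<eta> :: real assume "\<eta> > 0"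
  have [measurable]: "Z i \<in> borel_measurable M" "Z0 \<in> borel_measurable M" for i
    using indep int unfolding indep_vars_def by auto
  let ?T = "\<lambda>m x. max (- real m) (min (real m) x)"
  let ?R = "\<lambda>m x. \<bar>x - ?T m x\<bar>"
  have "eventually (\<lambda>m. expectation (\<lambda>\<omega>. ?R m (Z0 \<omega>)) < min (\<epsilon> / 3) (\<epsilon> * \<eta> / 6)) sequentially"
    using \<open>\<epsilon> > 0\<close> \<open>\<eta> > 0\<close>
    by (intro order_tendstoD(2)[OF expectation_truncation_error_tendsto_0[OF int]]) simp
  then obtain m where m: "m > 0" "expectation (\<lambda>\<omega>. ?R m (Z0 \<omega>)) < min (\<epsilon> / 3) (\<epsilon> * \<eta> / 6)"
    using eventually_gt_at_top[of 0] by (metis (mono_tags, lifting) eventually_conj eventually_sequentially order_refl)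
  have intT: "integrable M (\<lambda>\<omega>. ?T m (Z0 \<omega>))"
    by (rule integrable_const_bound[where B = "real m"]) auto
  have intR: "integrable M (\<lambda>\<omega>. ?R m (Z0 \<omega>))"
    using intT int by (intro integrable_abs Bochner_Integration.integrable_diff)
  have intRi: "integrable M (\<lambda>\<omega>. ?R m (Z i \<omega>))"
    and expRi: "expectation (\<lambda>\<omega>. ?R m (Z i \<omega>)) = expectation (\<lambda>\<omega>. ?R m (Z0 \<omega>))" for i
    using integral_cong_distr[of "Z i" Z0 "?R m"] distr[of i] intR by auto
  have mean: "\<bar>expectation Z0 - expectation (\<lambda>\<omega>. ?T m (Z0 \<omega>))\<bar> < \<epsilon> / 3"
  proof -
    have "expectation Z0 - expectation (\<lambda>\<omega>. ?T m (Z0 \<omega>)) = expectation (\<lambda>\<omega>. Z0 \<omega> - ?T m (Z0 \<omega>))"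
      using intT int by simp
    also have "\<bar>\<dots>\<bar> \<le> expectation (\<lambda>\<omega>. ?R m (Z0 \<omega>))" by (rule integral_abs_bound)
    finally show ?thesis using m by simp
  qed
  have "(\<lambda>n. 2 * exp (- (real n * (2 * (\<epsilon> / 3)\<^sup>2 / (2 * real m)\<^sup>2)))) \<longlonglongrightarrow> 2 * 0"
    by (intro tendsto_mult tendsto_const filterlim_compose[OF exp_at_bot]
        filterlim_compose[OF filterlim_uminus_at_bot_at_top] filterlim_at_top_mult_tendsto_pos[where c = "2 * (\<epsilon> / 3)\<^sup>2 / (2 * real m)\<^sup>2"]
        filterlim_real_sequentially)
      (use \<open>\<epsilon> > 0\<close> m in \<open>simp_all\<close>)
  then have "eventually (\<lambda>n. 2 * exp (- (real n * (2 * (\<epsilon> / 3)\<^sup>2 / (2 * real m)\<^sup>2))) < \<eta> / 2) sequentially"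
    by (rule order_tendstoD(2)) (use \<open>\<eta> > 0\<close> in simp)
  then have "eventually (\<lambda>n. n > 0 \<and> 2 * exp (- (real n * (2 * (\<epsilon> / 3)\<^sup>2 / (2 * real m)\<^sup>2))) < \<eta> / 2) sequentially"
    using eventually_gt_at_top[of "0::nat"] by eventually_elim auto
  then obtain N where N: "\<And>n. n \<ge> N \<Longrightarrow> n > 0 \<and> 2 * exp (- (real n * (2 * (\<epsilon> / 3)\<^sup>2 / (2 * real m)\<^sup>2))) < \<eta> / 2"
    unfolding eventually_sequentially by blast
  show "\<exists>N. \<forall>n\<ge>N. norm (prob {\<omega>\<in>space M. \<epsilon> \<le> \<bar>(\<Sum>i<n. Z i \<omega>) / n - expectation Z0\<bar>} - 0) < \<eta>"
  proof (intro exI[of _ N] allI impI)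
    fix n assume "n \<ge> N"
    note n = N[OF this]
    let ?A = "{\<omega>\<in>space M. \<epsilon> / 3 \<le> \<bar>(\<Sum>i<n. ?T m (Z i \<omega>)) / n - expectation (\<lambda>\<omega>. ?T m (Z0 \<omega>))\<bar>}"
    let ?B = "{\<omega>\<in>space M. \<epsilon> / 3 \<le> (\<Sum>i<n. ?R m (Z i \<omega>)) / n}"
    have "prob {\<omega>\<in>space M. \<epsilon> \<le> \<bar>(\<Sum>i<n. Z i \<omega>) / n - expectation Z0\<bar>} \<le> prob (?A \<union> ?B)"
    proof (rule finite_measure_mono)
      show "{\<omega>\<in>space M. \<epsilon> \<le> \<bar>(\<Sum>i<n. Z i \<omega>) / n - expectation Z0\<bar>} \<subseteq> ?A \<union> ?B"
      proof (rule subsetI, rule ccontr)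
        fix \<omega> assume *: "\<omega> \<in> {\<omega>\<in>space M. \<epsilon> \<le> \<bar>(\<Sum>i<n. Z i \<omega>) / n - expectation Z0\<bar>}" "\<omega> \<notin> ?A \<union> ?B"
        have "\<bar>(\<Sum>i<n. Z i \<omega>) / n - (\<Sum>i<n. ?T m (Z i \<omega>)) / n\<bar> = \<bar>\<Sum>i<n. Z i \<omega> - ?T m (Z i \<omega>)\<bar> / n"
          by (simp add: sum_subtractf diff_divide_distrib[symmetric])
        also have "\<dots> \<le> (\<Sum>i<n. ?R m (Z i \<omega>)) / n"
          by (intro divide_right_mono sum_abs) simp
        finally have 1: "\<bar>(\<Sum>i<n. Z i \<omega>) / n - (\<Sum>i<n. ?T m (Z i \<omega>)) / n\<bar> \<le> (\<Sum>i<n. ?R m (Z i \<omega>)) / n" .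
        have "\<epsilon> \<le> \<bar>(\<Sum>i<n. Z i \<omega>) / n - expectation Z0\<bar>"
          "\<bar>(\<Sum>i<n. ?T m (Z i \<omega>)) / n - expectation (\<lambda>\<omega>. ?T m (Z0 \<omega>))\<bar> < \<epsilon> / 3"
          "(\<Sum>i<n. ?R m (Z i \<omega>)) / n < \<epsilon> / 3"
          using * by (blast, blast intro: not_le_imp_less, blast intro: not_le_imp_less)
        then show False using 1 mean by linarith
      qed
    qed measurable
    also have "\<dots> \<le> prob ?A + prob ?B" by (rule measure_Un_le) measurable
    also have "prob ?A \<le> 2 * exp (- 2 * n * (\<epsilon> / 3)\<^sup>2 / (real m - - real m)\<^sup>2)"
    proof -
      interpret H: Hoeffding_ineq_iid M "{..<n}" "\<lambda>i \<omega>. ?T m (Z i \<omega>)" "\<lambda>\<omega>. ?T m (Z0 \<omega>)" "- real m" "real m"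
        "expectation (\<lambda>\<omega>. ?T m (Z0 \<omega>))"
      proof unfold_locales
        show "indep_vars (\<lambda>_. borel) (\<lambda>i \<omega>. ?T m (Z i \<omega>)) {..<n}"
          by (rule indep_vars_compose2[OF indep_vars_subset[OF indep]]) auto
        show "distr M borel (\<lambda>\<omega>. ?T m (Z i \<omega>)) = distr M borel (\<lambda>\<omega>. ?T m (Z0 \<omega>))" for i
        proof -
          have "distr (distr M borel (Z i)) borel (?T m) = distr (distr M borel Z0) borel (?T m)"
            by (simp add: distr)
          then show ?thesis by (simp add: distr_distr o_def)
        qed
      qed auto
      show ?thesis
        using H.Hoeffding_ineq_abs_ge'[of "\<epsilon> / 3"] \<open>\<epsilon> > 0\<close> m n by (auto simp: lessThan_empty_iff)
    qed
    also have "\<dots> < \<eta> / 2" using n by (simp add: power2_eq_square algebra_simps)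
    also have "prob ?B \<le> expectation (\<lambda>\<omega>. (\<Sum>i<n. ?R m (Z i \<omega>)) / n) / (\<epsilon> / 3)"
      by (rule integral_Markov_inequality_measure) (use intRi \<open>\<epsilon> > 0\<close> in \<open>auto intro!: AE_I2 divide_nonneg_nonneg sum_nonneg\<close>)
    also have "expectation (\<lambda>\<omega>. (\<Sum>i<n. ?R m (Z i \<omega>)) / n) = expectation (\<lambda>\<omega>. ?R m (Z0 \<omega>))"
      using n intRi by (simp add: Bochner_Integration.integral_sum expRi)
    also have "\<dots> / (\<epsilon> / 3) < \<eta> / 2" using m \<open>\<epsilon> > 0\<close> by (simp add: field_simps)
    finally show "norm (prob {\<omega>\<in>space M. \<epsilon> \<le> \<bar>(\<Sum>i<n. Z i \<omega>) / n - expectation Z0\<bar>} - 0) < \<eta>"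
      by simp
  qed
qed
end

section \<open>The naive equation as a convex minimisation problem\<close>

text \<open>A quadratic lower bound that holds for all \<open>x\<close> at the price of the linear denominator. On the negative axis
  \<open>exp x - 1 - x\<close> grows only linearly, so a denominator of this order is unavoidable.\<close>

lemma exp_minus_affine_ge:
  fixes x :: real
  shows "x\<^sup>2 / (2 * (1 + \<bar>x\<bar>)) \<le> exp x - 1 - x"
proof (cases "0 \<le> x")
  case True
  have "x\<^sup>2 / (2 * (1 + \<bar>x\<bar>)) \<le> x\<^sup>2 / 2"
    using True by (intro divide_left_mono) auto
  also have "\<dots> \<le> exp x - 1 - x"
    using exp_lower_Taylor_quadratic[OF True] by simp
  finally show ?thesis .
next
  case False
  define y where "y = - x"
  have "y \<ge> 0" using False by (simp add: y_def)
  \<comment> \<open>The claim at \<open>- y\<close> after multiplication by \<open>2 + 2 * y\<close>; \<open>g\<close> starts at \<open>0\<close>.\<close>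
  define g where "g u = exp (- u) * (2 + 2 * u) - 2 + u\<^sup>2" for u :: real
  have "g 0 \<le> g y"
  proof (rule DERIV_nonneg_imp_nondecreasing[OF \<open>y \<ge> 0\<close>])
    fix u :: real assume "0 \<le> u"
    have "(g has_real_derivative 2 * u * (1 - exp (- u))) (at u)"
      unfolding g_def by (auto intro!: derivative_eq_intros simp: algebra_simps)
    moreover have "0 \<le> 2 * u * (1 - exp (- u))" using \<open>0 \<le> u\<close> by simp
    ultimately show "\<exists>d. (g has_real_derivative d) (at u) \<and> 0 \<le> d" by blast
  qed
  then have "2 - y\<^sup>2 \<le> exp (- y) * (2 + 2 * y)" by (simp add: g_def)
  then show ?thesis
    using \<open>y \<ge> 0\<close> by (simp add: y_def field_simps power2_eq_square)
qed

text \<open>The negative Poisson log-likelihood, up to a summand that depends only on \<open>y\<close>.\<close>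

definition poisson_loss :: "nat \<Rightarrow> (nat \<Rightarrow> real) \<Rightarrow> (nat \<Rightarrow> real) \<Rightarrow> real \<times> real \<Rightarrow> real" where
  "poisson_loss n y w c = (\<Sum>i<n. exp (fst c + snd c * w i) - y i * (fst c + snd c * w i))"

lemma naive_equation_iff:
  assumes "n > 0"
  shows "naive_equation n y w c \<longleftrightarrow>
    (\<Sum>i<n. y i - exp (fst c + snd c * w i)) = 0 \<and> (\<Sum>i<n. (y i - exp (fst c + snd c * w i)) * w i) = 0"
  using assms by (simp add: naive_equation_def prod_eq_iff fst_sum snd_sum)

text \<open>First-order expansion with exact remainder. The remainder is nonnegative term by term, which gives
  minimality of stationary points; its lower bound gives the growth away from \<open>b\<close>.\<close>

lemma poisson_loss_diff:
  "poisson_loss n y w (c + v) - poisson_loss n y w c =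
    (\<Sum>i<n. exp (fst c + snd c * w i) *
      (exp (fst v + snd v * w i) - 1 - (fst v + snd v * w i)))
    - fst v * (\<Sum>i<n. y i - exp (fst c + snd c * w i))
    - snd v * (\<Sum>i<n. (y i - exp (fst c + snd c * w i)) * w i)"
  unfolding poisson_loss_def sum_distrib_left sum_subtractf[symmetric]
  by (intro sum.cong refl) (simp add: algebra_simps exp_add)

lemma naive_equation_imp_minimum:
  assumes "n > 0" "naive_equation n y w c"
  shows "poisson_loss n y w c \<le> poisson_loss n y w d"
proof -
  have "0 \<le> (\<Sum>i<n. exp (fst c + snd c * w i) *
      (exp (fst (d - c) + snd (d - c) * w i) - 1 - (fst (d - c) + snd (d - c) * w i)))"
  proof (intro sum_nonneg mult_nonneg_nonneg)
    fix i
    show "0 \<le> exp (fst (d - c) + snd (d - c) * w i) - 1 - (fst (d - c) + snd (d - c) * w i)"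
      using exp_ge_add_one_self[of "fst (d - c) + snd (d - c) * w i"] by linarith
  qed simp
  then show ?thesis
    using poisson_loss_diff[of n y w c "d - c"] assms by (simp add: naive_equation_iff)
qed

lemma convex_on_poisson_loss: "convex_on UNIV (poisson_loss n y w)"
proof (rule convex_onI)
  fix t :: real and x z :: "real \<times> real" assume t: "0 < t" "t < 1"
  have "exp (fst ((1 - t) *\<^sub>R x + t *\<^sub>R z) + snd ((1 - t) *\<^sub>R x + t *\<^sub>R z) * u)
      \<le> (1 - t) * exp (fst x + snd x * u) + t * exp (fst z + snd z * u)" for u
  proof -
    have "fst ((1 - t) *\<^sub>R x + t *\<^sub>R z) + snd ((1 - t) *\<^sub>R x + t *\<^sub>R z) * u
      = (1 - t) *\<^sub>R (fst x + snd x * u) + t *\<^sub>R (fst z + snd z * u)"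
      by (simp add: algebra_simps)
    then show ?thesis
      using convex_onD[OF exp_convex, of t "fst x + snd x * u" "fst z + snd z * u"] t by simp
  qed
  then have "poisson_loss n y w ((1 - t) *\<^sub>R x + t *\<^sub>R z)
    \<le> (\<Sum>i<n. ((1 - t) * exp (fst x + snd x * w i) + t * exp (fst z + snd z * w i))
        - y i * (fst ((1 - t) *\<^sub>R x + t *\<^sub>R z) + snd ((1 - t) *\<^sub>R x + t *\<^sub>R z) * w i))"
    unfolding poisson_loss_def by (intro sum_mono diff_mono) auto
  also have "\<dots> = (1 - t) * poisson_loss n y w x + t * poisson_loss n y w z"
    unfolding poisson_loss_def sum_distrib_left sum.distrib[symmetric]
    by (intro sum.cong refl) (simp add: algebra_simps)
  finally show "poisson_loss n y w ((1 - t) *\<^sub>R x + t *\<^sub>R z)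
    \<le> (1 - t) * poisson_loss n y w x + t * poisson_loss n y w z" .
qed simp

lemma continuous_on_poisson_loss: "continuous_on S (poisson_loss n y w)"
  unfolding poisson_loss_def by (intro continuous_intros)

lemma has_derivative_poisson_loss:
  "(poisson_loss n y w has_derivative
     (\<lambda>v. - fst v * (\<Sum>i<n. y i - exp (fst c + snd c * w i))
          - snd v * (\<Sum>i<n. (y i - exp (fst c + snd c * w i)) * w i))) (at c)"
proof -
  have "(poisson_loss n y w has_derivative
     (\<lambda>v. \<Sum>i<n. (fst v + snd v * w i) * exp (fst c + snd c * w i) - y i * (fst v + snd v * w i))) (at c)"
    unfolding poisson_loss_def
    by (intro has_derivative_sum) (auto intro!: derivative_eq_intros simp: algebra_simps)
  also have "(\<lambda>v. \<Sum>i<n. (fst v + snd v * w i) * exp (fst c + snd c * w i) - y i * (fst v + snd v * w i)) =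
     (\<lambda>v. - fst v * (\<Sum>i<n. y i - exp (fst c + snd c * w i))
          - snd v * (\<Sum>i<n. (y i - exp (fst c + snd c * w i)) * w i))"
    unfolding sum_distrib_left sum_subtractf[symmetric]
    by (intro ext sum.cong refl) (simp add: algebra_simps)
  finally show ?thesis .
qed

lemma local_minimum_imp_naive_equation:
  assumes "n > 0" "open S" "c \<in> S" "\<And>d. d \<in> S \<Longrightarrow> poisson_loss n y w c \<le> poisson_loss n y w d"
  shows "naive_equation n y w c"
proof -
  have D: "(\<lambda>v. - fst v * (\<Sum>i<n. y i - exp (fst c + snd c * w i))
          - snd v * (\<Sum>i<n. (y i - exp (fst c + snd c * w i)) * w i)) = (\<lambda>v. 0)"
    by (rule differential_zero_maxmin[OF assms(3,2) has_derivative_poisson_loss]) (use assms(4) in blast)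
  show ?thesis
    using fun_cong[OF D, of "(1, 0)"] fun_cong[OF D, of "(0, 1)"] assms(1)
    by (simp add: naive_equation_iff)
qed

text \<open>A convex function that is larger on a sphere than at its centre has all its minimisers inside the
  sphere: one exists by compactness, and a minimiser outside would, by convexity along the segment
  from the centre, force a small value on the sphere.\<close>

lemma naive_equation_solution_near:
  fixes b :: "real \<times> real"
  assumes "n > 0" "\<epsilon> > 0"
    and sphere: "\<And>v. norm v = \<epsilon> \<Longrightarrow> poisson_loss n y w b < poisson_loss n y w (b + v)"
  shows "\<exists>c. naive_equation n y w c"
    and "naive_equation n y w c \<Longrightarrow> dist c b < \<epsilon>"
proof -
  let ?L = "poisson_loss n y w"
  obtain c where c: "c \<in> cball b \<epsilon>" "\<And>d. d \<in> cball b \<epsilon> \<Longrightarrow> ?L c \<le> ?L d"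
    using continuous_attains_inf[OF compact_cball, of b \<epsilon> ?L] continuous_on_poisson_loss \<open>\<epsilon> > 0\<close> by force
  have "dist b c \<noteq> \<epsilon>"
  proof
    assume "dist b c = \<epsilon>"
    then have "?L b < ?L (b + (c - b))"
      by (intro sphere) (simp add: dist_norm norm_minus_commute)
    then show False using c(2)[of b] \<open>\<epsilon> > 0\<close> by simp
  qed
  then have "c \<in> ball b \<epsilon>" using c(1) by auto
  then show "\<exists>c. naive_equation n y w c"
    using local_minimum_imp_naive_equation[OF \<open>n > 0\<close> open_ball, of c b \<epsilon> y w] c(2) ball_subset_cball
    by (metis subsetD)
next
  let ?L = "poisson_loss n y w"
  assume c: "naive_equation n y w c"
  show "dist c b < \<epsilon>"
  proof (rule ccontr)
    assume "\<not> dist c b < \<epsilon>"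
    then have far: "\<epsilon> \<le> norm (c - b)" by (simp add: dist_norm)
    define \<tau> where "\<tau> = \<epsilon> / norm (c - b)"
    have \<tau>: "0 \<le> \<tau>" "\<tau> \<le> 1" using far \<open>\<epsilon> > 0\<close> by (auto simp: \<tau>_def divide_le_eq_1)
    have "norm (c - b) > 0" using far \<open>\<epsilon> > 0\<close> by linarith
    then have "norm (\<tau> *\<^sub>R (c - b)) = \<epsilon>" using \<open>\<epsilon> > 0\<close> by (simp add: \<tau>_def)
    then have "?L b < ?L (b + \<tau> *\<^sub>R (c - b))" by (rule sphere)
    also have "b + \<tau> *\<^sub>R (c - b) = (1 - \<tau>) *\<^sub>R b + \<tau> *\<^sub>R c"
      by (simp add: algebra_simps)
    also have "?L \<dots> \<le> (1 - \<tau>) * ?L b + \<tau> * ?L c"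
      using convex_onD[OF convex_on_poisson_loss \<tau>] by simp
    also have "\<dots> \<le> (1 - \<tau>) * ?L b + \<tau> * ?L b"
      using naive_equation_imp_minimum[OF \<open>n > 0\<close> c, of b] \<tau> by (intro add_left_mono mult_left_mono)
    finally show False by (simp add: algebra_simps)
  qed
qed

text \<open>For \<open>norm v \<le> 1\<close> one has \<open>1 + \<bar>fst v + snd v * w\<bar> \<le> 2 + \<bar>w\<bar>\<close>, so the denominator of
  \<open>exp_minus_affine_ge\<close> can be replaced by one that is free of \<open>v\<close>. This makes the lower bound of the loss
  an honest quadratic form in \<open>v\<close>, with random coefficients that are averages.\<close>

definition curvature_weight :: "real \<times> real \<Rightarrow> real \<Rightarrow> real" where
  "curvature_weight b w = exp (fst b + snd b * w) / (2 * (2 + \<bar>w\<bar>))"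

lemma poisson_loss_growth:
  assumes "norm v \<le> 1"
  shows "(\<Sum>i<n. curvature_weight b (w i) * (fst v + snd v * w i)\<^sup>2)
    - fst v * (\<Sum>i<n. y i - exp (fst b + snd b * w i))
    - snd v * (\<Sum>i<n. (y i - exp (fst b + snd b * w i)) * w i)
    \<le> poisson_loss n y w (b + v) - poisson_loss n y w b"
  unfolding poisson_loss_diff
proof (intro diff_right_mono sum_mono)
  fix i
  let ?x = "fst v + snd v * w i"
  have "\<bar>fst v\<bar> \<le> 1" "\<bar>snd v\<bar> \<le> 1"
    using assms norm_fst_le[of "fst v" "snd v"] norm_snd_le[of "snd v" "fst v"] by auto
  then have "\<bar>?x\<bar> \<le> 1 + \<bar>w i\<bar>"
    using abs_triangle_ineq[of "fst v" "snd v * w i"] mult_right_mono[of "\<bar>snd v\<bar>" 1 "\<bar>w i\<bar>"]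
    by (simp add: abs_mult)
  then have "?x\<^sup>2 / (2 * (2 + \<bar>w i\<bar>)) \<le> ?x\<^sup>2 / (2 * (1 + \<bar>?x\<bar>))"
    by (intro divide_left_mono mult_pos_pos) auto
  also have "\<dots> \<le> exp ?x - 1 - ?x" by (rule exp_minus_affine_ge)
  finally have "exp (fst b + snd b * w i) * (?x\<^sup>2 / (2 * (2 + \<bar>w i\<bar>)))
     \<le> exp (fst b + snd b * w i) * (exp ?x - 1 - ?x)" by (intro mult_left_mono) auto
  then show "curvature_weight b (w i) * ?x\<^sup>2 \<le> exp (fst b + snd b * w i) * (exp ?x - 1 - ?x)"
    by (simp add: curvature_weight_def)
qed

text \<open>The smallest value \<open>\<mu>\<close> of the form on the unit circle is positive, and a perturbation of each
  coefficient by at most \<open>\<mu> / 3\<close> changes the form by at most \<open>2 \<mu> / 3\<close> there. A single constant serves as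
  the size of the perturbation and as the remaining lower bound.\<close>

lemma positive_definite_stable:
  fixes A B C :: real
  assumes "\<And>v :: real \<times> real. v \<noteq> 0 \<Longrightarrow> 0 < A * (fst v)\<^sup>2 + 2 * B * fst v * snd v + C * (snd v)\<^sup>2"
  obtains \<kappa> where "\<kappa> > 0"
    "\<And>A' B' C' v. \<lbrakk>\<bar>A' - A\<bar> < \<kappa>; \<bar>B' - B\<bar> < \<kappa>; \<bar>C' - C\<bar> < \<kappa>\<rbrakk> \<Longrightarrow>
       \<kappa> * (norm v)\<^sup>2 \<le> A' * (fst v)\<^sup>2 + 2 * B' * fst v * snd v + C' * (snd v)\<^sup>2"
proof -
  let ?Q = "\<lambda>A B C (v :: real \<times> real). A * (fst v)\<^sup>2 + 2 * B * fst v * snd v + C * (snd v)\<^sup>2"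
  have "sphere 0 1 \<noteq> ({} :: (real \<times> real) set)" by simp
  moreover have "continuous_on (sphere 0 1) (?Q A B C)" by (intro continuous_intros)
  ultimately obtain u where u: "u \<in> sphere 0 1" "\<And>v. v \<in> sphere 0 1 \<Longrightarrow> ?Q A B C u \<le> ?Q A B C v"
    using continuous_attains_inf[OF compact_sphere] by blast
  define \<mu> where "\<mu> = ?Q A B C u"
  have "\<mu> > 0" unfolding \<mu>_def using u(1) by (intro assms) auto
  have Q: "\<mu> * (norm v)\<^sup>2 \<le> ?Q A B C v" for v
  proof (cases "v = 0")
    case False
    have "\<mu> \<le> ?Q A B C (v /\<^sub>R norm v)"
      unfolding \<mu>_def using False by (intro u(2)) simp
    also have "\<dots> = ?Q A B C v / (norm v)\<^sup>2"
      using False by (simp add: field_simps power2_eq_square)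
    finally show ?thesis using False by (simp add: field_simps)
  qed simp
  show thesis
  proof (rule that[of "\<mu> / 3"])
    show "\<mu> / 3 > 0" using \<open>\<mu> > 0\<close> by simp
    fix A' B' C' v
    assume close: "\<bar>A' - A\<bar> < \<mu> / 3" "\<bar>B' - B\<bar> < \<mu> / 3" "\<bar>C' - C\<bar> < \<mu> / 3"
    have n: "(norm v)\<^sup>2 = (fst v)\<^sup>2 + (snd v)\<^sup>2" by (simp add: norm_prod_def)
    have "- (\<mu> / 3) * (fst v)\<^sup>2 \<le> (A' - A) * (fst v)\<^sup>2"
      by (intro mult_right_mono) (use close(1) in linarith, simp)
    moreover have "- (\<mu> / 3) * (snd v)\<^sup>2 \<le> (C' - C) * (snd v)\<^sup>2"
      by (intro mult_right_mono) (use close(3) in linarith, simp)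
    moreover have "- (\<mu> / 3) * ((fst v)\<^sup>2 + (snd v)\<^sup>2) \<le> 2 * (B' - B) * fst v * snd v"
    proof -
      have "\<bar>2 * (B' - B) * fst v * snd v\<bar> = \<bar>B' - B\<bar> * (2 * \<bar>fst v\<bar> * \<bar>snd v\<bar>)"
        by (simp only: abs_mult)
      also have "\<dots> \<le> (\<mu> / 3) * ((fst v)\<^sup>2 + (snd v)\<^sup>2)"
        using close \<open>\<mu> > 0\<close> sum_squares_bound[of "\<bar>fst v\<bar>" "\<bar>snd v\<bar>"] by (intro mult_mono) auto
      finally show ?thesis by linarith
    qed
    ultimately show "\<mu> / 3 * (norm v)\<^sup>2 \<le> ?Q A' B' C' v"
      using Q[of v] by (simp add: n algebra_simps)
  qed
qed

section \<open>Consistency of the naive estimator\<close>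

context prob_space begin

lemma prob_tendsto_0_disj:
  assumes "(\<lambda>n. prob {\<omega>\<in>space M. P n \<omega>}) \<longlonglongrightarrow> 0" "(\<lambda>n. prob {\<omega>\<in>space M. Q n \<omega>}) \<longlonglongrightarrow> 0"
    and [measurable]: "\<And>n. Measurable.pred M (P n)" "\<And>n. Measurable.pred M (Q n)"
  shows "(\<lambda>n. prob {\<omega>\<in>space M. P n \<omega> \<or> Q n \<omega>}) \<longlonglongrightarrow> 0"
proof (rule tendsto_sandwich[OF _ _ tendsto_const])
  show "\<forall>\<^sub>F n in sequentially. prob {\<omega>\<in>space M. P n \<omega> \<or> Q n \<omega>}
      \<le> prob {\<omega>\<in>space M. P n \<omega>} + prob {\<omega>\<in>space M. Q n \<omega>}"
  proof (rule always_eventually, rule allI)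
    fix n
    have "{\<omega>\<in>space M. P n \<omega> \<or> Q n \<omega>} = {\<omega>\<in>space M. P n \<omega>} \<union> {\<omega>\<in>space M. Q n \<omega>}" by auto
    then show "prob {\<omega>\<in>space M. P n \<omega> \<or> Q n \<omega>} \<le> prob {\<omega>\<in>space M. P n \<omega>} + prob {\<omega>\<in>space M. Q n \<omega>}"
      by (simp add: measure_Un_le)
  qed
  show "(\<lambda>n. prob {\<omega>\<in>space M. P n \<omega>} + prob {\<omega>\<in>space M. Q n \<omega>}) \<longlonglongrightarrow> 0"
    using tendsto_add[OF assms(1,2)] by simp
qed auto

lemma prob_tendsto_0_mono:
  assumes "(\<lambda>n. prob {\<omega>\<in>space M. Q n \<omega>}) \<longlonglongrightarrow> 0"
    and [measurable]: "\<And>n. Measurable.pred M (Q n)"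
    and "eventually (\<lambda>n. \<forall>\<omega>\<in>space M. P n \<omega> \<longrightarrow> Q n \<omega>) sequentially"
  shows "(\<lambda>n. prob {\<omega>\<in>space M. P n \<omega>}) \<longlonglongrightarrow> 0"
proof (rule tendsto_sandwich[OF _ _ tendsto_const assms(1)])
  show "\<forall>\<^sub>F n in sequentially. prob {\<omega>\<in>space M. P n \<omega>} \<le> prob {\<omega>\<in>space M. Q n \<omega>}"
    using assms(3) by eventually_elim (rule finite_measure_mono, auto)
qed simp

lemma integrable_exp_affine_moment:
  assumes [measurable]: "W \<in> borel_measurable M" and "mgf_exists M W t"
  shows "integrable M (\<lambda>\<omega>. exp (s + t * W \<omega>) * W \<omega> ^ k)"
    and "expectation (\<lambda>\<omega>. exp (s + t * W \<omega>) * W \<omega> ^ k) = exp s * exp_moment M W k t"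
proof -
  have eq: "exp (s + t * W \<omega>) * W \<omega> ^ k = exp s * (W \<omega> ^ k * exp (t * W \<omega>))" for \<omega>
    by (simp add: exp_add)
  show "integrable M (\<lambda>\<omega>. exp (s + t * W \<omega>) * W \<omega> ^ k)"
    unfolding eq by (intro integrable_mult_right mgf_exists_integrable_moment assms)
  show "expectation (\<lambda>\<omega>. exp (s + t * W \<omega>) * W \<omega> ^ k) = exp s * exp_moment M W k t"
    unfolding eq exp_moment_def by simp
qed

lemma limiting_equation_score:
  assumes "limiting_equation M Y W b"
  shows "integrable M (\<lambda>\<omega>. Y \<omega> - exp (fst b + snd b * W \<omega>))"
    and "expectation (\<lambda>\<omega>. Y \<omega> - exp (fst b + snd b * W \<omega>)) = 0"
    and "integrable M (\<lambda>\<omega>. (Y \<omega> - exp (fst b + snd b * W \<omega>)) * W \<omega>)"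
    and "expectation (\<lambda>\<omega>. (Y \<omega> - exp (fst b + snd b * W \<omega>)) * W \<omega>) = 0"
  using has_bochner_integral_bounded_linear[OF bounded_linear_fst assms[unfolded limiting_equation_def]]
    has_bochner_integral_bounded_linear[OF bounded_linear_snd assms[unfolded limiting_equation_def]]
  by (auto simp: has_bochner_integral_iff)

lemma borel_measurable_curvature_weight [measurable]:
  "curvature_weight b \<in> borel_measurable borel"
  unfolding curvature_weight_def by measurable

lemma curvature_weight_pos: "curvature_weight b w > 0"
  by (auto simp: curvature_weight_def intro!: divide_pos_pos)

lemma integrable_curvature_weight_moment:
  assumes [measurable]: "W \<in> borel_measurable M" and "mgf_exists M W (snd b)"
  shows "integrable M (\<lambda>\<omega>. curvature_weight b (W \<omega>) * W \<omega> ^ k)"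
proof (rule Bochner_Integration.integrable_bound[OF integrable_exp_affine_moment(1)[OF assms, of "fst b" k]])
  show "AE \<omega> in M. norm (curvature_weight b (W \<omega>) * W \<omega> ^ k) \<le> norm (exp (fst b + snd b * W \<omega>) * W \<omega> ^ k)"
  proof (rule AE_I2)
    fix \<omega>
    have "curvature_weight b (W \<omega>) \<le> exp (fst b + snd b * W \<omega>) / 1"
      unfolding curvature_weight_def by (intro divide_left_mono) auto
    then show "norm (curvature_weight b (W \<omega>) * W \<omega> ^ k) \<le> norm (exp (fst b + snd b * W \<omega>) * W \<omega> ^ k)"
      using curvature_weight_pos[of b "W \<omega>"] by (auto simp: abs_mult intro!: mult_right_mono)
  qed
qed simp

text \<open>The form is the expectation of a positive weight times \<open>(fst v + snd v * W)\<^sup>2\<close>, so it can vanish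
  only if \<open>W\<close> is almost surely constant.\<close>

lemma curvature_form_pos:
  assumes [measurable]: "W \<in> borel_measurable M" and ex: "mgf_exists M W (snd b)"
    and nonconst: "\<not> (\<exists>c. AE \<omega> in M. W \<omega> = c)" and "v \<noteq> 0"
  defines "m \<equiv> \<lambda>k. expectation (\<lambda>\<omega>. curvature_weight b (W \<omega>) * W \<omega> ^ k)"
  shows "0 < m 0 * (fst v)\<^sup>2 + 2 * m 1 * fst v * snd v + m 2 * (snd v)\<^sup>2"
proof -
  note int = integrable_curvature_weight_moment[OF assms(1) ex]
  have sq: "curvature_weight b (W \<omega>) * (fst v + snd v * W \<omega>)\<^sup>2 =
      (fst v)\<^sup>2 * (curvature_weight b (W \<omega>) * W \<omega> ^ 0)
      + 2 * fst v * snd v * (curvature_weight b (W \<omega>) * W \<omega> ^ 1)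
      + (snd v)\<^sup>2 * (curvature_weight b (W \<omega>) * W \<omega> ^ 2)" for \<omega>
    by (simp add: power2_eq_square algebra_simps)
  have int_sq: "integrable M (\<lambda>\<omega>. curvature_weight b (W \<omega>) * (fst v + snd v * W \<omega>)\<^sup>2)"
    unfolding sq by (intro Bochner_Integration.integrable_add integrable_mult_right int)
  have "expectation (\<lambda>\<omega>. curvature_weight b (W \<omega>) * (fst v + snd v * W \<omega>)\<^sup>2)
      = (fst v)\<^sup>2 * m 0 + 2 * fst v * snd v * m 1 + (snd v)\<^sup>2 * m 2"
    unfolding sq m_def
    by (simp only: Bochner_Integration.integral_add Bochner_Integration.integrable_add
        integrable_mult_right int integral_mult_right_zero)
  moreover have "expectation (\<lambda>\<omega>. curvature_weight b (W \<omega>) * (fst v + snd v * W \<omega>)\<^sup>2) \<noteq> 0"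
  proof
    assume "expectation (\<lambda>\<omega>. curvature_weight b (W \<omega>) * (fst v + snd v * W \<omega>)\<^sup>2) = 0"
    then have "AE \<omega> in M. curvature_weight b (W \<omega>) * (fst v + snd v * W \<omega>)\<^sup>2 = 0"
      by (subst (asm) integral_nonneg_eq_0_iff_AE[OF int_sq])
        (auto intro!: AE_I2 mult_nonneg_nonneg less_imp_le[OF curvature_weight_pos])
    then have ae: "AE \<omega> in M. fst v + snd v * W \<omega> = 0"
      by eventually_elim (use curvature_weight_pos[of b] in \<open>auto simp: less_le\<close>)
    show False
    proof (cases "snd v = 0")
      case True
      then have "AE \<omega> in M. fst v = 0" using ae by simp
      then show False using True \<open>v \<noteq> 0\<close> by (simp add: prod_eq_iff)
    next
      case False
      have "AE \<omega> in M. W \<omega> = - fst v / snd v"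
        using ae by eventually_elim (use False in \<open>simp add: field_simps eq_neg_iff_add_eq_0\<close>)
      then show False using nonconst by blast
    qed
  qed
  moreover have "expectation (\<lambda>\<omega>. curvature_weight b (W \<omega>) * (fst v + snd v * W \<omega>)\<^sup>2) \<ge> 0"
    by (intro Bochner_Integration.integral_nonneg mult_nonneg_nonneg less_imp_le[OF curvature_weight_pos]) simp
  ultimately show ?thesis by (simp add: algebra_simps)
qed

text \<open>Five laws of large numbers, two for the score and three for the coefficients of the quadratic form,
  put the sample outside the event \<open>bad\<close> with probability tending to \<open>1\<close>; there the argument is
  deterministic.\<close>

lemma naive_estimator_consistent:
  fixes Ys Ws :: "nat \<Rightarrow> 'a \<Rightarrow> real"
  assumes [measurable]: "Y \<in> borel_measurable M" "W \<in> borel_measurable M"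
    and indep: "indep_vars (\<lambda>_. borel) (\<lambda>i \<omega>. (Ys i \<omega>, Ws i \<omega>)) UNIV"
    and distr: "\<And>i. distr M borel (\<lambda>\<omega>. (Ys i \<omega>, Ws i \<omega>)) = distr M borel (\<lambda>\<omega>. (Y \<omega>, W \<omega>))"
    and naive: "naive_estimator M Ys Ws \<beta>N"
    and lim: "limiting_equation M Y W b"
    and ex: "mgf_exists M W (snd b)" and nonconst: "\<not> (\<exists>c. AE \<omega> in M. W \<omega> = c)"
  shows "converges_in_probability M \<beta>N b"
proof -
  have pair_meas: "(\<lambda>\<omega>. (Ys i \<omega>, Ws i \<omega>)) \<in> borel_measurable M" for i
    using indep by (simp add: indep_vars_def)
  have [measurable]: "Ys i \<in> borel_measurable M" "Ws i \<in> borel_measurable M" for i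
    using measurable_compose[OF pair_meas, of fst borel i] measurable_compose[OF pair_meas, of snd borel i]
    by (simp_all add: borel_measurable_continuous_onI continuous_on_fst continuous_on_snd)
  have [measurable]: "\<beta>N n \<in> borel_measurable M" for n
    using naive by (simp add: naive_estimator_def)
  have lln: "(\<lambda>n. prob {\<omega>\<in>space M. \<delta> \<le> \<bar>(\<Sum>i<n. g (Ys i \<omega>, Ws i \<omega>)) / n - expectation (\<lambda>\<omega>. g (Y \<omega>, W \<omega>))\<bar>}) \<longlonglongrightarrow> 0"
    if "g \<in> borel_measurable (borel \<Otimes>\<^sub>M borel)" and "integrable M (\<lambda>\<omega>. g (Y \<omega>, W \<omega>))" "\<delta> > 0"
    for g :: "real \<times> real \<Rightarrow> real" and \<delta>
  proof (rule weak_law_of_large_numbers)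
    have [measurable]: "g \<in> borel_measurable borel" using that(1) by (simp add: borel_prod)
    show "integrable M (\<lambda>\<omega>. g (Y \<omega>, W \<omega>))" "\<delta> > 0" by fact+
    show "indep_vars (\<lambda>_. borel) (\<lambda>i \<omega>. g (Ys i \<omega>, Ws i \<omega>)) UNIV"
      by (rule indep_vars_compose2[OF indep]) simp
    have "distr (distr M borel (\<lambda>\<omega>. (Ys i \<omega>, Ws i \<omega>))) borel g = distr (distr M borel (\<lambda>\<omega>. (Y \<omega>, W \<omega>))) borel g" for i
      by (simp add: distr)
    then show "distr M borel (\<lambda>\<omega>. g (Ys i \<omega>, Ws i \<omega>)) = distr M borel (\<lambda>\<omega>. g (Y \<omega>, W \<omega>))" for i
      by (simp add: distr_distr o_def pair_meas)
  qed
  define m where "m k = expectation (\<lambda>\<omega>. curvature_weight b (W \<omega>) * W \<omega> ^ k)" for k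
  have "0 < m 0 * (fst v)\<^sup>2 + 2 * m 1 * fst v * snd v + m 2 * (snd v)\<^sup>2" if "v \<noteq> 0" for v
    unfolding m_def by (rule curvature_form_pos[OF assms(2) ex nonconst that])
  then obtain \<kappa> where "\<kappa> > 0" and form:
    "\<And>A B C v. \<lbrakk>\<bar>A - m 0\<bar> < \<kappa>; \<bar>B - m 1\<bar> < \<kappa>; \<bar>C - m 2\<bar> < \<kappa>\<rbrakk> \<Longrightarrow>
       \<kappa> * (norm v)\<^sup>2 \<le> A * (fst v)\<^sup>2 + 2 * B * fst v * snd v + C * (snd v)\<^sup>2"
    using positive_definite_stable[of "m 0" "m 1" "m 2"] by metis
  show ?thesis
    unfolding converges_in_probability_def
  proof (intro conjI allI impI)
    fix \<epsilon> :: real assume "\<epsilon> > 0"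
    \<comment> \<open>The quadratic lower bound of the loss holds only for increments of norm at most \<open>1\<close>.\<close>
    define e where "e = min \<epsilon> 1"
    have e: "e > 0" "e \<le> 1" "e \<le> \<epsilon>" using \<open>\<epsilon> > 0\<close> by (auto simp: e_def)
    define S0 where "S0 n \<omega> = (\<Sum>i<n. Ys i \<omega> - exp (fst b + snd b * Ws i \<omega>)) / real n" for n \<omega>
    define S1 where "S1 n \<omega> = (\<Sum>i<n. (Ys i \<omega> - exp (fst b + snd b * Ws i \<omega>)) * Ws i \<omega>) / real n" for n \<omega>
    define H where "H k n \<omega> = (\<Sum>i<n. curvature_weight b (Ws i \<omega>) * Ws i \<omega> ^ k) / real n" for k n \<omega>
    have [measurable]: "S0 n \<in> borel_measurable M" "S1 n \<in> borel_measurable M" "H k n \<in> borel_measurable M" for k n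
      unfolding S0_def S1_def H_def by measurable
    have score_meas: "(\<lambda>p. fst p - exp (fst b + snd b * snd p)) \<in> borel_measurable (borel \<Otimes>\<^sub>M borel)"
      "(\<lambda>p. (fst p - exp (fst b + snd b * snd p)) * snd p) \<in> borel_measurable (borel \<Otimes>\<^sub>M borel)"
      "(\<lambda>p. curvature_weight b (snd p) * snd p ^ k) \<in> borel_measurable (borel \<Otimes>\<^sub>M borel)" for k
      by measurable
    have S0: "(\<lambda>n. prob {\<omega>\<in>space M. \<kappa> * e / 2 \<le> \<bar>S0 n \<omega>\<bar>}) \<longlonglongrightarrow> 0"
      using lln[of "\<lambda>p. fst p - exp (fst b + snd b * snd p)" "\<kappa> * e / 2", OF score_meas(1)]
        limiting_equation_score(1,2)[OF lim] \<open>\<kappa> > 0\<close> e(1) by (simp add: S0_def)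
    have S1: "(\<lambda>n. prob {\<omega>\<in>space M. \<kappa> * e / 2 \<le> \<bar>S1 n \<omega>\<bar>}) \<longlonglongrightarrow> 0"
      using lln[of "\<lambda>p. (fst p - exp (fst b + snd b * snd p)) * snd p" "\<kappa> * e / 2", OF score_meas(2)]
        limiting_equation_score(3,4)[OF lim] \<open>\<kappa> > 0\<close> e(1) by (simp add: S1_def)
    have H: "(\<lambda>n. prob {\<omega>\<in>space M. \<kappa> \<le> \<bar>H k n \<omega> - m k\<bar>}) \<longlonglongrightarrow> 0" for k
      using lln[of "\<lambda>p. curvature_weight b (snd p) * snd p ^ k" \<kappa>, OF score_meas(3)]
        integrable_curvature_weight_moment[OF assms(2) ex, of k] \<open>\<kappa> > 0\<close> by (simp add: H_def m_def)
    \<comment> \<open>With the score below \<open>\<kappa> e / 2\<close>, the linear part is below \<open>\<kappa> e\<^sup>2\<close> on the sphere of radius \<open>e\<close>.\<close>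
    let ?bad = "\<lambda>n \<omega>. (\<kappa> * e / 2 \<le> \<bar>S0 n \<omega>\<bar> \<or> \<kappa> * e / 2 \<le> \<bar>S1 n \<omega>\<bar>) \<or>
       \<kappa> \<le> \<bar>H 0 n \<omega> - m 0\<bar> \<or> \<kappa> \<le> \<bar>H 1 n \<omega> - m 1\<bar> \<or> \<kappa> \<le> \<bar>H 2 n \<omega> - m 2\<bar>"
    have bad: "(\<lambda>n. prob {\<omega>\<in>space M. ?bad n \<omega>}) \<longlonglongrightarrow> 0"
      by (intro prob_tendsto_0_disj S0 S1 H) measurable
    show "(\<lambda>n. prob {\<omega>\<in>space M. \<epsilon> \<le> dist (\<beta>N n \<omega>) b}) \<longlonglongrightarrow> 0"
    proof (rule prob_tendsto_0_mono[OF bad])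
      show "\<forall>\<^sub>F n in sequentially. \<forall>\<omega>\<in>space M. \<epsilon> \<le> dist (\<beta>N n \<omega>) b \<longrightarrow> ?bad n \<omega>"
      proof (rule eventually_mono[OF eventually_gt_at_top[of "0::nat"]], intro ballI impI, rule ccontr)
        fix n :: nat and \<omega> assume "n > 0" and \<omega>: "\<omega> \<in> space M"
          and far: "\<epsilon> \<le> dist (\<beta>N n \<omega>) b" and good: "\<not> ?bad n \<omega>"
        have nH: "real n * H k n \<omega> = (\<Sum>i<n. curvature_weight b (Ws i \<omega>) * Ws i \<omega> ^ k)" for k
          using \<open>n > 0\<close> by (simp add: H_def)
        let ?L = "poisson_loss n (\<lambda>i. Ys i \<omega>) (\<lambda>i. Ws i \<omega>)"
        have sphere: "?L b < ?L (b + v)" if "norm v = e" for v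
        proof -
          have "\<bar>fst v\<bar> \<le> e" "\<bar>snd v\<bar> \<le> e"
            using that norm_fst_le[of "fst v" "snd v"] norm_snd_le[of "snd v" "fst v"] by auto
          then have "\<bar>fst v * S0 n \<omega>\<bar> \<le> e * \<bar>S0 n \<omega>\<bar>" "\<bar>snd v * S1 n \<omega>\<bar> \<le> e * \<bar>S1 n \<omega>\<bar>"
            by (auto simp: abs_mult intro!: mult_right_mono)
          moreover have "e * \<bar>S0 n \<omega>\<bar> < e * (\<kappa> * e / 2)" "e * \<bar>S1 n \<omega>\<bar> < e * (\<kappa> * e / 2)"
            using good e by (auto intro!: mult_strict_left_mono)
          moreover have "\<kappa> * e\<^sup>2 \<le> H 0 n \<omega> * (fst v)\<^sup>2 + 2 * H 1 n \<omega> * fst v * snd v + H 2 n \<omega> * (snd v)\<^sup>2"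
            using form[of "H 0 n \<omega>" "H 1 n \<omega>" "H 2 n \<omega>" v] good that by auto
          moreover have "e * (\<kappa> * e / 2) + e * (\<kappa> * e / 2) = \<kappa> * e\<^sup>2"
            by (simp add: power2_eq_square)
          ultimately have "0 < H 0 n \<omega> * (fst v)\<^sup>2 + 2 * H 1 n \<omega> * fst v * snd v + H 2 n \<omega> * (snd v)\<^sup>2
              - fst v * S0 n \<omega> - snd v * S1 n \<omega>" by linarith
          then have "0 < real n * (H 0 n \<omega> * (fst v)\<^sup>2 + 2 * H 1 n \<omega> * fst v * snd v + H 2 n \<omega> * (snd v)\<^sup>2
              - fst v * S0 n \<omega> - snd v * S1 n \<omega>)" using \<open>n > 0\<close> by simp
          also have "\<dots> = (real n * H 0 n \<omega>) * (fst v)\<^sup>2 + 2 * (real n * H 1 n \<omega>) * fst v * snd v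
              + (real n * H 2 n \<omega>) * (snd v)\<^sup>2
              - fst v * (real n * S0 n \<omega>) - snd v * (real n * S1 n \<omega>)"
            by (simp add: algebra_simps)
          also have "(real n * H 0 n \<omega>) * (fst v)\<^sup>2 + 2 * (real n * H 1 n \<omega>) * fst v * snd v
              + (real n * H 2 n \<omega>) * (snd v)\<^sup>2
              = (\<Sum>i<n. curvature_weight b (Ws i \<omega>) * (fst v + snd v * Ws i \<omega>)\<^sup>2)"
            unfolding nH sum_distrib_left sum_distrib_right sum.distrib[symmetric]
            by (intro sum.cong refl) (simp add: power2_eq_square algebra_simps)
          also have "\<dots> - fst v * (real n * S0 n \<omega>) - snd v * (real n * S1 n \<omega>) \<le> ?L (b + v) - ?L b"
            using poisson_loss_growth[where v=v and b=b and n=n and y="\<lambda>i. Ys i \<omega>" and w="\<lambda>i. Ws i \<omega>"]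
              that e \<open>n > 0\<close> by (simp add: S0_def S1_def)
          finally show ?thesis by simp
        qed
        have sol: "naive_equation n (\<lambda>i. Ys i \<omega>) (\<lambda>i. Ws i \<omega>) (\<beta>N n \<omega>)"
          using naive_equation_solution_near(1)[OF \<open>n > 0\<close> \<open>e > 0\<close> sphere] naive \<omega>
          unfolding naive_estimator_def by blast
        show False
          using naive_equation_solution_near(2)[OF \<open>n > 0\<close> \<open>e > 0\<close> sphere sol] far e by simp
      qed
    qed measurable
  qed simp
qed

end

section \<open>Moments under Poisson regression\<close>

lemma sums_poisson_mean:
  fixes r :: real
  shows "(\<lambda>k. real k * (r ^ k / fact k * exp (- r))) sums r"
proof -
  have "(\<lambda>k. r ^ k /\<^sub>R fact k) sums exp r" by (rule exp_converges)
  then have "(\<lambda>k. (r * exp (- r)) * (r ^ k /\<^sub>R fact k)) sums ((r * exp (- r)) * exp r)"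
    by (rule sums_mult)
  moreover have "(r * exp (- r)) * (r ^ k /\<^sub>R fact k) = real (Suc k) * (r ^ Suc k / fact (Suc k) * exp (- r))" for k
  proof -
    have "(r * exp (- r)) * (r ^ k /\<^sub>R f) = s * (r ^ Suc k / (s * f) * exp (- r))" if "s \<noteq> 0" for s f :: real
      using that by (simp add: divide_inverse)
    from this[of "real (Suc k)" "fact k"] show ?thesis unfolding fact_Suc by simp
  qed
  moreover have "(r * exp (- r)) * exp r = r" by (simp add: mult.assoc exp_add[symmetric])
  ultimately have "(\<lambda>k. real (Suc k) * (r ^ Suc k / fact (Suc k) * exp (- r))) sums r" by simp
  then show ?thesis by (subst (asm) sums_Suc_iff) simp
qed

lemma prob_map_pmf_real_poisson:
  assumes "r > 0"
  shows "measure_pmf.prob (map_pmf real (poisson_pmf r)) {real k} = r ^ k / fact k * exp (- r)"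
proof -
  have "real -` {real k} = {k}" by auto
  then show ?thesis using assms by (subst measure_map_pmf, simp only:) (simp add: measure_pmf_single)
qed

context prob_space begin

lemma poisson_regression_prob:
  assumes [measurable]: "X \<in> borel_measurable M" "Y \<in> borel_measurable M"
    and "poisson_regression M X Y \<beta>" and [measurable]: "A \<in> sets borel" "B \<in> sets borel"
  defines "p \<equiv> \<lambda>x. measure_pmf.prob (map_pmf real (poisson_pmf (exp (fst \<beta> + snd \<beta> * x)))) B"
  assumes [measurable]: "p \<in> borel_measurable borel"
  shows "prob {\<omega>\<in>space M. X \<omega> \<in> A \<and> Y \<omega> \<in> B} = expectation (\<lambda>\<omega>. indicator A (X \<omega>) * p (X \<omega>))"
proof -
  let ?F = "vimage_algebra (space M) X borel"
  have "subalgebra M ?F"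
    unfolding subalgebra_def by (auto simp: sets_vimage_algebra2 intro: measurable_sets)
  then interpret F: finite_measure_subalgebra M ?F by unfold_locales
  have fX: "(\<lambda>\<omega>. indicator A (X \<omega>) :: real) \<in> borel_measurable ?F"
    by (rule measurable_compose[OF measurable_vimage_algebra1]) auto
  let ?I = "indicator (Y -` B \<inter> space M) :: 'a \<Rightarrow> real"
  have "prob {\<omega>\<in>space M. X \<omega> \<in> A \<and> Y \<omega> \<in> B} = expectation (\<lambda>\<omega>. indicator A (X \<omega>) * ?I \<omega>)"
  proof -
    have "expectation (\<lambda>\<omega>. indicator A (X \<omega>) * ?I \<omega>)
        = expectation (indicator {\<omega>\<in>space M. X \<omega> \<in> A \<and> Y \<omega> \<in> B})"
      by (rule Bochner_Integration.integral_cong) (auto simp: indicator_def)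
    then show ?thesis by simp
  qed
  also have "\<dots> = expectation (\<lambda>\<omega>. indicator A (X \<omega>) * real_cond_exp M ?F ?I \<omega>)"
  proof (rule F.real_cond_exp_intg(2)[symmetric])
    show "integrable M (\<lambda>\<omega>. indicator A (X \<omega>) * ?I \<omega>)"
    proof (rule integrable_const_bound[where B = 1])
      show "AE \<omega> in M. norm (indicator A (X \<omega>) * ?I \<omega>) \<le> 1"
        by (rule AE_I2) (simp add: indicator_def)
    qed simp
  qed (use fX in simp_all)
  also have "\<dots> = expectation (\<lambda>\<omega>. indicator A (X \<omega>) * p (X \<omega>))"
  proof (rule integral_cong_AE)
    have "AE \<omega> in M. real_cond_exp M ?F ?I \<omega> = p (X \<omega>)"
      using assms unfolding poisson_regression_def p_def by blast
    then show "AE \<omega> in M. indicator A (X \<omega>) * real_cond_exp M ?F ?I \<omega> = indicator A (X \<omega>) * p (X \<omega>)"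
      by auto
  qed (simp_all add: borel_measurable_cond_exp2)
  finally show ?thesis .
qed

text \<open>The defining property of the conditional law determines the joint law on rectangles; comparing the
  two image measures on the line extends it to all nonnegative functions of \<open>X\<close>.\<close>

lemma poisson_regression_nn_integral_atom:
  assumes [measurable]: "X \<in> borel_measurable M" "Y \<in> borel_measurable M"
    and pr: "poisson_regression M X Y \<beta>" and [measurable]: "f \<in> borel_measurable borel"
  defines "r \<equiv> \<lambda>x. exp (fst \<beta> + snd \<beta> * x)"
  shows "(\<integral>\<^sup>+\<omega>. f (X \<omega>) * indicator {real k} (Y \<omega>) \<partial>M)
    = (\<integral>\<^sup>+\<omega>. f (X \<omega>) * ennreal (r (X \<omega>) ^ k / fact k * exp (- r (X \<omega>))) \<partial>M)"
proof -
  have [measurable]: "r \<in> borel_measurable borel" unfolding r_def by measurable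
  define q where "q x = r x ^ k / fact k * exp (- r x)" for x
  have [measurable]: "q \<in> borel_measurable borel" unfolding q_def by measurable
  have q: "q x \<ge> 0" "q x \<le> 1" for x
  proof -
    have *: "q x = measure_pmf.prob (map_pmf real (poisson_pmf (r x))) {real k}"
      by (simp only: q_def, subst prob_map_pmf_real_poisson) (auto simp: r_def)
    show "q x \<ge> 0" "q x \<le> 1" unfolding * by (auto intro: measure_pmf.prob_le_1)
  qed
  have "distr (density M (\<lambda>\<omega>. indicator {real k} (Y \<omega>))) borel X = distr (density M (\<lambda>\<omega>. ennreal (q (X \<omega>)))) borel X"
  proof (rule measure_eqI)
    fix A assume "A \<in> sets (distr (density M (\<lambda>\<omega>. indicator {real k} (Y \<omega>))) borel X)"
    then have [measurable]: "A \<in> sets borel" by simp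
    have p_eq: "(\<lambda>x. measure_pmf.prob (map_pmf real (poisson_pmf (exp (fst \<beta> + snd \<beta> * x)))) {real k}) = q"
      by (rule ext, subst prob_map_pmf_real_poisson) (simp_all add: q_def r_def)
    have int: "integrable M (\<lambda>\<omega>. indicator A (X \<omega>) * q (X \<omega>))"
      by (rule integrable_const_bound[where B = 1]) (use q in \<open>auto simp: indicator_def\<close>)
    have "emeasure (distr (density M (\<lambda>\<omega>. indicator {real k} (Y \<omega>))) borel X) A
        = (\<integral>\<^sup>+\<omega>. indicator {real k} (Y \<omega>) * indicator (X -` A \<inter> space M) \<omega> \<partial>M)"
      by (simp add: emeasure_distr emeasure_density)
    also have "\<dots> = (\<integral>\<^sup>+\<omega>. indicator {\<omega>\<in>space M. X \<omega> \<in> A \<and> Y \<omega> \<in> {real k}} \<omega> \<partial>M)"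
      by (rule nn_integral_cong) (auto simp: indicator_def)
    also have "\<dots> = ennreal (prob {\<omega>\<in>space M. X \<omega> \<in> A \<and> Y \<omega> \<in> {real k}})"
      by (simp add: emeasure_eq_measure)
    also have "prob {\<omega>\<in>space M. X \<omega> \<in> A \<and> Y \<omega> \<in> {real k}} = expectation (\<lambda>\<omega>. indicator A (X \<omega>) * q (X \<omega>))"
      by (subst poisson_regression_prob[OF assms(1-3)]) (simp_all only: p_eq fun_cong[OF p_eq], simp_all)
    also have "\<dots> = (\<integral>\<^sup>+\<omega>. ennreal (indicator A (X \<omega>) * q (X \<omega>)) \<partial>M)"
      using q by (intro nn_integral_eq_integral[symmetric] int) auto
    also have "\<dots> = (\<integral>\<^sup>+\<omega>. ennreal (q (X \<omega>)) * indicator (X -` A \<inter> space M) \<omega> \<partial>M)"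
      by (rule nn_integral_cong) (auto simp: indicator_def)
    also have "\<dots> = emeasure (distr (density M (\<lambda>\<omega>. ennreal (q (X \<omega>)))) borel X) A"
      by (simp add: emeasure_distr emeasure_density)
    finally show "emeasure (distr (density M (\<lambda>\<omega>. indicator {real k} (Y \<omega>))) borel X) A
      = emeasure (distr (density M (\<lambda>\<omega>. ennreal (q (X \<omega>)))) borel X) A" .
  qed simp
  then have "(\<integral>\<^sup>+x. f x \<partial>distr (density M (\<lambda>\<omega>. indicator {real k} (Y \<omega>))) borel X)
      = (\<integral>\<^sup>+x. f x \<partial>distr (density M (\<lambda>\<omega>. ennreal (q (X \<omega>)))) borel X)"
    by simp
  then show ?thesis
    by (simp add: nn_integral_distr nn_integral_density q_def mult.commute)
qed

text \<open>Needed because \<open>Y\<close> is real-valued: it allows \<open>Y\<close> to be expanded over its atoms.\<close>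

lemma poisson_regression_AE_nat:
  assumes [measurable]: "X \<in> borel_measurable M" "Y \<in> borel_measurable M"
    and pr: "poisson_regression M X Y \<beta>"
  shows "AE \<omega> in M. Y \<omega> \<in> range real"
proof -
  have [measurable]: "- range real \<in> sets borel"
    by (rule borel_comp, rule sets.countable) auto
  have "real -` (- range real) = {}" by blast
  then have p: "measure_pmf.prob (map_pmf real q) (- range real) = 0" for q
    by (subst measure_map_pmf) simp
  have "prob {\<omega>\<in>space M. X \<omega> \<in> UNIV \<and> Y \<omega> \<in> - range real} = 0"
    by (subst poisson_regression_prob[OF assms]) (simp_all add: p del: measure_map_pmf)
  moreover have "{\<omega>\<in>space M. Y \<omega> \<in> - range real} \<in> events" by measurable
  ultimately show ?thesis
    by (subst AE_iff_measurable[OF _ refl]) (auto simp: emeasure_eq_measure)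
qed

lemma poisson_regression_nn_integral:
  assumes [measurable]: "X \<in> borel_measurable M" "Y \<in> borel_measurable M"
    and pr: "poisson_regression M X Y \<beta>" and [measurable]: "f \<in> borel_measurable borel"
  shows "(\<integral>\<^sup>+\<omega>. f (X \<omega>) * ennreal (Y \<omega>) \<partial>M)
    = (\<integral>\<^sup>+\<omega>. f (X \<omega>) * ennreal (exp (fst \<beta> + snd \<beta> * X \<omega>)) \<partial>M)"
proof -
  define r where "r x = exp (fst \<beta> + snd \<beta> * x)" for x
  have [measurable]: "r \<in> borel_measurable borel" unfolding r_def by measurable
  have Y: "(\<Sum>k. ennreal (real k) * indicator {real k} y) = ennreal y" if "y \<in> range real" for y
  proof -
    obtain j where j: "y = real j" using \<open>y \<in> range real\<close> by blast
    have "(\<Sum>k. ennreal (real k) * indicator {real k} y) = (\<Sum>k\<in>{j}. ennreal (real k) * indicator {real k} y)"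
      by (rule suminf_finite) (auto simp: j)
    then show ?thesis by (simp add: j)
  qed
  have pull_out: "(\<Sum>k. ennreal (real k) * (c * d k)) = c * (\<Sum>k. ennreal (real k) * d k)" for c d
    by (subst ennreal_suminf_cmult[symmetric]) (simp add: mult.left_commute)
  have "(\<integral>\<^sup>+\<omega>. f (X \<omega>) * ennreal (Y \<omega>) \<partial>M)
      = (\<integral>\<^sup>+\<omega>. (\<Sum>k. ennreal (real k) * (f (X \<omega>) * indicator {real k} (Y \<omega>))) \<partial>M)"
    using poisson_regression_AE_nat[OF assms(1-3)]
    by (intro nn_integral_cong_AE, eventually_elim)
      (simp only: pull_out Y)
  also have "\<dots> = (\<Sum>k. ennreal (real k) * (\<integral>\<^sup>+\<omega>. f (X \<omega>) * indicator {real k} (Y \<omega>) \<partial>M))"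
    by (subst nn_integral_suminf) (simp_all add: nn_integral_cmult)
  also have "\<dots> = (\<Sum>k. ennreal (real k) * (\<integral>\<^sup>+\<omega>. f (X \<omega>) * ennreal (r (X \<omega>) ^ k / fact k * exp (- r (X \<omega>))) \<partial>M))"
    using poisson_regression_nn_integral_atom[OF assms] by (simp add: r_def)
  also have "\<dots> = (\<integral>\<^sup>+\<omega>. (\<Sum>k. ennreal (real k) * (f (X \<omega>) * ennreal (r (X \<omega>) ^ k / fact k * exp (- r (X \<omega>))))) \<partial>M)"
    by (subst nn_integral_suminf) (simp_all add: nn_integral_cmult)
  also have "\<dots> = (\<integral>\<^sup>+\<omega>. f (X \<omega>) * ennreal (r (X \<omega>)) \<partial>M)"
  proof (rule nn_integral_cong)
    fix \<omega>
    let ?r = "r (X \<omega>)"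
    have "(\<Sum>k. ennreal (real k) * (f (X \<omega>) * ennreal (?r ^ k / fact k * exp (- ?r))))
       = f (X \<omega>) * (\<Sum>k. ennreal (real k * (?r ^ k / fact k * exp (- ?r))))"
      unfolding pull_out by (subst ennreal_mult) (simp_all add: r_def)
    also have "(\<Sum>k. ennreal (real k * (?r ^ k / fact k * exp (- ?r)))) = ennreal ?r"
      by (rule suminf_ennreal_eq[OF _ sums_poisson_mean]) (simp add: r_def)
    finally show "(\<Sum>k. ennreal (real k) * (f (X \<omega>) * ennreal (?r ^ k / fact k * exp (- ?r))))
       = f (X \<omega>) * ennreal ?r" .
  qed
  finally show ?thesis by (simp add: r_def)
qed

lemma poisson_regression_expectation:
  fixes g :: "real \<Rightarrow> real"
  assumes [measurable]: "X \<in> borel_measurable M" "Y \<in> borel_measurable M"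
    and pr: "poisson_regression M X Y \<beta>" and [measurable]: "g \<in> borel_measurable borel"
    and int: "integrable M (\<lambda>\<omega>. g (X \<omega>) * exp (fst \<beta> + snd \<beta> * X \<omega>))"
  shows "integrable M (\<lambda>\<omega>. g (X \<omega>) * Y \<omega>)"
    and "expectation (\<lambda>\<omega>. g (X \<omega>) * Y \<omega>) = expectation (\<lambda>\<omega>. g (X \<omega>) * exp (fst \<beta> + snd \<beta> * X \<omega>))"
proof -
  have Y: "AE \<omega> in M. 0 \<le> Y \<omega>"
    using poisson_regression_AE_nat[OF assms(1-3)] by eventually_elim auto
  have eq: "(\<integral>\<^sup>+\<omega>. ennreal (h (X \<omega>) * Y \<omega>) \<partial>M) = (\<integral>\<^sup>+\<omega>. ennreal (h (X \<omega>) * exp (fst \<beta> + snd \<beta> * X \<omega>)) \<partial>M)"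
    if [measurable]: "h \<in> borel_measurable borel" for h :: "real \<Rightarrow> real"
  proof -
    have "(\<integral>\<^sup>+\<omega>. ennreal (h (X \<omega>) * Y \<omega>) \<partial>M) = (\<integral>\<^sup>+\<omega>. ennreal (h (X \<omega>)) * ennreal (Y \<omega>) \<partial>M)"
      using Y by (intro nn_integral_cong_AE, eventually_elim) (simp add: ennreal_mult'')
    also have "\<dots> = (\<integral>\<^sup>+\<omega>. ennreal (h (X \<omega>)) * ennreal (exp (fst \<beta> + snd \<beta> * X \<omega>)) \<partial>M)"
      by (rule poisson_regression_nn_integral[OF assms(1-3), of "\<lambda>x. ennreal (h x)"]) simp
    finally show ?thesis by (simp add: ennreal_mult'')
  qed
  have "(\<integral>\<^sup>+\<omega>. ennreal (norm (g (X \<omega>) * Y \<omega>)) \<partial>M) = (\<integral>\<^sup>+\<omega>. ennreal (\<bar>g (X \<omega>)\<bar> * Y \<omega>) \<partial>M)"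
    using Y by (intro nn_integral_cong_AE, eventually_elim) (simp add: abs_mult)
  also have "\<dots> = (\<integral>\<^sup>+\<omega>. ennreal (norm (g (X \<omega>) * exp (fst \<beta> + snd \<beta> * X \<omega>))) \<partial>M)"
    using eq[of "\<lambda>x. \<bar>g x\<bar>"] by (simp add: abs_mult)
  also have "\<dots> < \<infinity>" using int by (simp add: integrable_iff_bounded)
  finally show *: "integrable M (\<lambda>\<omega>. g (X \<omega>) * Y \<omega>)"
    by (simp add: integrable_iff_bounded)
  show "expectation (\<lambda>\<omega>. g (X \<omega>) * Y \<omega>) = expectation (\<lambda>\<omega>. g (X \<omega>) * exp (fst \<beta> + snd \<beta> * X \<omega>))"
    unfolding real_lebesgue_integral_def[OF *] real_lebesgue_integral_def[OF int]
    using eq[of g] eq[of "\<lambda>x. - g x"] by simp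
qed
end

section \<open>Independent measurement error and identification\<close>

context prob_space begin

lemma indep_var_of_indep_vimage_algebras:
  fixes U :: "'a \<Rightarrow> real" and V :: "'a \<Rightarrow> 'b::topological_space" and f :: "'b \<Rightarrow> real"
  assumes [measurable]: "U \<in> borel_measurable M" "V \<in> borel_measurable M" "f \<in> borel_measurable borel"
    and indep: "indep_set (sets (vimage_algebra (space M) U borel)) (sets (vimage_algebra (space M) V borel))"
  shows "indep_var borel U borel (\<lambda>\<omega>. f (V \<omega>))"
proof -
  have "sigma_sets (space M) {(\<lambda>\<omega>. f (V \<omega>)) -` A \<inter> space M |A. A \<in> sets borel}
      \<subseteq> sigma_sets (space M) {V -` A \<inter> space M |A. A \<in> sets borel}"
  proof (rule sigma_sets_mono', safe)
    fix A :: "real set" assume "A \<in> sets borel"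
    then have "f -` A \<in> sets borel" using measurable_sets[of f borel borel A] by simp
    moreover have "(\<lambda>\<omega>. f (V \<omega>)) -` A \<inter> space M = V -` (f -` A) \<inter> space M" by auto
    ultimately show "\<exists>B. (\<lambda>\<omega>. f (V \<omega>)) -` A \<inter> space M = V -` B \<inter> space M \<and> B \<in> sets borel"
      by blast
  qed
  then have "indep_set (sigma_sets (space M) {U -` A \<inter> space M |A. A \<in> sets borel})
      (sigma_sets (space M) {(\<lambda>\<omega>. f (V \<omega>)) -` A \<inter> space M |A. A \<in> sets borel})"
    using indep unfolding indep_sets2_eq sets_vimage_algebra by blast
  then show ?thesis by (simp add: indep_var_eq)
qed

lemma indep_set_swap: "indep_set A B \<Longrightarrow> indep_set B A"
  unfolding indep_sets2_eq
proof (elim conjE, intro conjI ballI)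
  fix b a assume *: "b \<in> B" "a \<in> A" "\<forall>a\<in>A. \<forall>b\<in>B. prob (a \<inter> b) = prob a * prob b"
  then have "prob (a \<inter> b) = prob a * prob b" by blast
  then show "prob (b \<inter> a) = prob b * prob a" by (simp only: Int_commute mult.commute)
qed

lemma indep_var_swap: "indep_var S A T B \<Longrightarrow> indep_var T B S A"
  unfolding indep_var_eq using indep_set_swap by blast

lemma mgf_add_indep:
  fixes X U :: "'a \<Rightarrow> real"
  assumes indep: "indep_var borel X borel U"
    and "integrable M (\<lambda>\<omega>. exp (s * X \<omega>))" "integrable M (\<lambda>\<omega>. exp (s * U \<omega>))"
  shows "integrable M (\<lambda>\<omega>. exp (s * (X \<omega> + U \<omega>)))"
    and "mgf M (\<lambda>\<omega>. X \<omega> + U \<omega>) s = mgf M X s * mgf M U s"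
proof -
  have i: "indep_var borel (\<lambda>\<omega>. exp (s * X \<omega>)) borel (\<lambda>\<omega>. exp (s * U \<omega>))"
    using indep_var_compose[OF indep, of "\<lambda>x. exp (s * x)" borel "\<lambda>x. exp (s * x)" borel]
    by (simp add: o_def)
  have eq: "exp (s * (X \<omega> + U \<omega>)) = exp (s * X \<omega>) * exp (s * U \<omega>)" for \<omega>
    by (simp add: distrib_left exp_add)
  show "integrable M (\<lambda>\<omega>. exp (s * (X \<omega> + U \<omega>)))"
    unfolding eq by (rule indep_var_integrable[OF i assms(2,3)])
  show "mgf M (\<lambda>\<omega>. X \<omega> + U \<omega>) s = mgf M X s * mgf M U s"
    unfolding mgf_def eq by (rule indep_var_lebesgue_integral[OF i assms(2,3)])
qed

lemma mgf_exists_add_indep: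
  fixes X U :: "'a \<Rightarrow> real"
  assumes "indep_var borel X borel U" "mgf_exists M X t" "mgf_exists M U t"
  shows "mgf_exists M (\<lambda>\<omega>. X \<omega> + U \<omega>) t"
proof -
  let ?N = "{t. mgf_exists M X t} \<inter> {t. mgf_exists M U t}"
  have "?N \<subseteq> {s. integrable M (\<lambda>\<omega>. exp (s * (X \<omega> + U \<omega>)))}"
    using mgf_add_indep(1)[OF assms(1)] mgf_exists_imp_integrable by blast
  then have "?N \<subseteq> interior {s. integrable M (\<lambda>\<omega>. exp (s * (X \<omega> + U \<omega>)))}"
    by (intro interior_maximal open_Int open_mgf_exists)
  then show ?thesis using assms unfolding mgf_exists_def by blast
qed

lemma cgf_add_indep:
  fixes X U :: "'a \<Rightarrow> real"
  assumes "indep_var borel X borel U" "mgf_exists M X t" "mgf_exists M U t"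
  shows "cgf M (\<lambda>\<omega>. X \<omega> + U \<omega>) t = cgf M X t + cgf M U t"
  using mgf_pos[OF assms(2)] mgf_pos[OF assms(3)]
    mgf_add_indep(2)[OF assms(1) mgf_exists_imp_integrable[OF assms(2)] mgf_exists_imp_integrable[OF assms(3)]]
  by (simp add: cgf_def ln_mult)

lemma tilted_cumulants_add_indep:
  fixes X U :: "'a \<Rightarrow> real"
  assumes indep: "indep_var borel X borel U" and ex: "mgf_exists M X t" "mgf_exists M U t"
  shows "tilted_mean (\<lambda>\<omega>. X \<omega> + U \<omega>) t = tilted_mean X t + tilted_mean U t"
    and "tilted_variance (\<lambda>\<omega>. X \<omega> + U \<omega>) t = tilted_variance X t + tilted_variance U t"
proof -
  let ?W = "\<lambda>\<omega>. X \<omega> + U \<omega>"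
  let ?N = "{t. mgf_exists M X t} \<inter> {t. mgf_exists M U t}"
  have [measurable]: "X \<in> borel_measurable M" "U \<in> borel_measurable M"
    using indep_var_rv1[OF indep] indep_var_rv2[OF indep] by simp_all
  have op: "open ?N" by (intro open_Int open_mgf_exists)
  have mean: "tilted_mean ?W t = tilted_mean X t + tilted_mean U t" if t: "t \<in> ?N" for t
  proof (rule DERIV_unique)
    show "(cgf M ?W has_real_derivative tilted_mean ?W t) (at t)"
      using t mgf_exists_add_indep[OF indep] by (intro has_real_derivative_cgf) auto
    have "((\<lambda>t. cgf M X t + cgf M U t) has_real_derivative tilted_mean X t + tilted_mean U t) (at t)"
      using t by (intro DERIV_add has_real_derivative_cgf) auto
    then show "(cgf M ?W has_real_derivative tilted_mean X t + tilted_mean U t) (at t)"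
      using op t by (rule has_field_derivative_transform_within_open) (simp add: cgf_add_indep[OF indep])
  qed
  then show "tilted_mean ?W t = tilted_mean X t + tilted_mean U t" using ex by simp
  show "tilted_variance ?W t = tilted_variance X t + tilted_variance U t"
  proof (rule DERIV_unique)
    show "(tilted_mean ?W has_real_derivative tilted_variance ?W t) (at t)"
      using ex mgf_exists_add_indep[OF indep] by (intro has_real_derivative_tilted_mean) auto
    have "((\<lambda>t. tilted_mean X t + tilted_mean U t) has_real_derivative tilted_variance X t + tilted_variance U t) (at t)"
      using ex by (intro DERIV_add has_real_derivative_tilted_mean) auto
    then show "(tilted_mean ?W has_real_derivative tilted_variance X t + tilted_variance U t) (at t)"
      using op by (rule has_field_derivative_transform_within_open) (use ex mean in auto)
  qed
qed

text \<open>Cancellation is impossible for independent summands, as their tilted variances add up.\<close>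

lemma not_AE_const_add_indep:
  fixes X U :: "'a \<Rightarrow> real"
  assumes indep: "indep_var borel X borel U" and ex: "mgf_exists M X t" "mgf_exists M U t"
    and nonconst: "\<not> (\<exists>c. AE \<omega> in M. X \<omega> = c)"
  shows "\<not> (\<exists>c. AE \<omega> in M. X \<omega> + U \<omega> = c)"
proof -
  have [measurable]: "X \<in> borel_measurable M" "U \<in> borel_measurable M"
    using indep_var_rv1[OF indep] indep_var_rv2[OF indep] by simp_all
  have "tilted_variance X t \<noteq> 0" using tilted_variance_eq_0_iff[of X t] ex nonconst by simp
  then have "tilted_variance (\<lambda>\<omega>. X \<omega> + U \<omega>) t \<noteq> 0"
    using tilted_cumulants_add_indep(2)[OF assms(1-3)] tilted_variance_nonneg[of X t] tilted_variance_nonneg[of U t]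
    by linarith
  then show ?thesis
    using tilted_variance_eq_0_iff[of "\<lambda>\<omega>. X \<omega> + U \<omega>" t] mgf_exists_add_indep[OF assms(1-3)] by simp
qed

text \<open>Both equations compare the two descriptions of \<open>E Y\<close> and \<open>E (W Y)\<close>: the one by the model and
  independence on the side of \<open>\<beta>\<close>, the one by the limiting equation on the side of \<open>b\<close>.\<close>

lemma poisson_regression_identification:
  fixes X Y U :: "'a \<Rightarrow> real"
  assumes [measurable]: "X \<in> borel_measurable M" "Y \<in> borel_measurable M"
    and pr: "poisson_regression M X Y \<beta>" and exX: "mgf_exists M X (snd \<beta>)"
    and intU: "integrable M U" and indep: "indep_var borel U borel Y"
    and lim: "limiting_equation M Y (\<lambda>\<omega>. X \<omega> + U \<omega>) b"
    and exW: "mgf_exists M (\<lambda>\<omega>. X \<omega> + U \<omega>) (snd b)"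
  shows "exp (fst \<beta>) * mgf M X (snd \<beta>) = exp (fst b) * mgf M (\<lambda>\<omega>. X \<omega> + U \<omega>) (snd b)"
    and "tilted_mean (\<lambda>\<omega>. X \<omega> + U \<omega>) (snd b) = tilted_mean X (snd \<beta>) + expectation U"
proof -
  have [measurable]: "U \<in> borel_measurable M" using intU by simp
  let ?W = "\<lambda>\<omega>. X \<omega> + U \<omega>"
  note mX = integrable_exp_affine_moment[OF assms(1) exX, of "fst \<beta>"]
  note mW = integrable_exp_affine_moment[OF _ exW, of "fst b"]
  have Y: "integrable M Y" "expectation Y = exp (fst \<beta>) * mgf M X (snd \<beta>)"
    using poisson_regression_expectation[OF assms(1,2) pr, of "\<lambda>_. 1"] mX[of 0]
    by (simp_all add: exp_moment_0)
  have XY: "integrable M (\<lambda>\<omega>. X \<omega> * Y \<omega>)"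
    "expectation (\<lambda>\<omega>. X \<omega> * Y \<omega>) = exp (fst \<beta>) * exp_moment M X 1 (snd \<beta>)"
    using poisson_regression_expectation[OF assms(1,2) pr, of "\<lambda>x. x"] mX[of 1]
    by (simp_all add: mult.commute)
  have UY: "integrable M (\<lambda>\<omega>. U \<omega> * Y \<omega>)" "expectation (\<lambda>\<omega>. U \<omega> * Y \<omega>) = expectation U * expectation Y"
    using indep_var_integrable[OF indep intU Y(1)] indep_var_lebesgue_integral[OF indep intU Y(1)] by auto
  have W: "integrable M (\<lambda>\<omega>. exp (fst b + snd b * ?W \<omega>))" "integrable M (\<lambda>\<omega>. exp (fst b + snd b * ?W \<omega>) * ?W \<omega>)"
    using mW(1)[of 0] mW(1)[of 1] by simp_all
  have EW: "expectation (\<lambda>\<omega>. exp (fst b + snd b * ?W \<omega>)) = exp (fst b) * mgf M ?W (snd b)"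
    "expectation (\<lambda>\<omega>. exp (fst b + snd b * ?W \<omega>) * ?W \<omega>) = exp (fst b) * exp_moment M ?W 1 (snd b)"
    using mW(2)[of 0] mW(2)[of 1] by (simp_all add: exp_moment_0)
  have "expectation (\<lambda>\<omega>. Y \<omega> - exp (fst b + snd b * ?W \<omega>)) = expectation Y - exp (fst b) * mgf M ?W (snd b)"
    using Bochner_Integration.integral_diff[OF Y(1) W(1)] EW(1) by simp
  then show mgf_eq: "exp (fst \<beta>) * mgf M X (snd \<beta>) = exp (fst b) * mgf M ?W (snd b)"
    using limiting_equation_score(2)[OF lim] Y(2) by simp
  have "expectation (\<lambda>\<omega>. (Y \<omega> - exp (fst b + snd b * ?W \<omega>)) * ?W \<omega>)
      = expectation (\<lambda>\<omega>. (X \<omega> * Y \<omega> + U \<omega> * Y \<omega>) - exp (fst b + snd b * ?W \<omega>) * ?W \<omega>)"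
    by (intro Bochner_Integration.integral_cong refl) (simp add: algebra_simps)
  also have "\<dots> = (expectation (\<lambda>\<omega>. X \<omega> * Y \<omega>) + expectation (\<lambda>\<omega>. U \<omega> * Y \<omega>)) - exp (fst b) * exp_moment M ?W 1 (snd b)"
    using Bochner_Integration.integral_diff[OF Bochner_Integration.integrable_add[OF XY(1) UY(1)] W(2)]
      Bochner_Integration.integral_add[OF XY(1) UY(1)] EW(2) by simp
  finally have "exp (fst \<beta>) * exp_moment M X 1 (snd \<beta>) + expectation U * (exp (fst \<beta>) * mgf M X (snd \<beta>))
      = exp (fst b) * exp_moment M ?W 1 (snd b)"
    using limiting_equation_score(4)[OF lim] XY(2) UY(2) Y(2) by simp
  moreover have "exp_moment M X 1 (snd \<beta>) = tilted_mean X (snd \<beta>) * mgf M X (snd \<beta>)"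
    "exp_moment M ?W 1 (snd b) = tilted_mean ?W (snd b) * mgf M ?W (snd b)"
    using mgf_pos[OF exX] mgf_pos[OF exW] by (simp_all add: tilted_mean_def)
  ultimately have "(tilted_mean X (snd \<beta>) + expectation U) * (exp (fst \<beta>) * mgf M X (snd \<beta>))
      = tilted_mean ?W (snd b) * (exp (fst b) * mgf M ?W (snd b))"
    by (simp add: algebra_simps)
  then show "tilted_mean ?W (snd b) = tilted_mean X (snd \<beta>) + expectation U"
    unfolding mgf_eq using mgf_pos[OF exW] by simp
qed

end

section \<open>The correction map\<close>

context prob_space begin

text \<open>Continuity is required at the limit only, so \<open>f\<close> may jump elsewhere, as the correction map may do at the
  boundary of the set where the correction system is solvable.\<close>

lemma converges_in_probability_continuous_image:
  fixes f :: "'b::{second_countable_topology, metric_space} \<Rightarrow> 'c::{second_countable_topology, metric_space}"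
  assumes conv: "converges_in_probability M Z c"
    and [measurable]: "f \<in> borel_measurable borel" and "isCont f c"
  shows "converges_in_probability M (\<lambda>n \<omega>. f (Z n \<omega>)) (f c)"
  unfolding converges_in_probability_def
proof (intro conjI allI impI)
  have [measurable]: "Z n \<in> borel_measurable M" for n
    using conv by (simp add: converges_in_probability_def)
  show "(\<lambda>\<omega>. f (Z n \<omega>)) \<in> borel_measurable M" for n by measurable
  fix \<epsilon> :: real assume "\<epsilon> > 0"
  then obtain \<delta> where \<delta>: "\<delta> > 0" "\<And>x. dist x c < \<delta> \<Longrightarrow> dist (f x) (f c) < \<epsilon>"
    using \<open>isCont f c\<close> unfolding continuous_at_eps_delta by blast
  show "(\<lambda>n. prob {\<omega>\<in>space M. \<epsilon> \<le> dist (f (Z n \<omega>)) (f c)}) \<longlonglongrightarrow> 0"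
  proof (rule prob_tendsto_0_mono)
    show "(\<lambda>n. prob {\<omega>\<in>space M. \<delta> \<le> dist (Z n \<omega>) c}) \<longlonglongrightarrow> 0"
      using conv \<delta>(1) by (simp add: converges_in_probability_def)
    show "\<forall>\<^sub>F n in sequentially. \<forall>\<omega>\<in>space M. \<epsilon> \<le> dist (f (Z n \<omega>)) (f c) \<longrightarrow> \<delta> \<le> dist (Z n \<omega>) c"
      using \<delta>(2) by (intro always_eventually) (force simp: not_less[symmetric])
  qed measurable
qed

lemma converges_in_probability_imp_prob_open:
  assumes conv: "converges_in_probability M Z c" and "open V" "c \<in> V"
  shows "(\<lambda>n. prob {\<omega>\<in>space M. Z n \<omega> \<in> V}) \<longlonglongrightarrow> 1"
proof -
  have [measurable]: "Z n \<in> borel_measurable M" "V \<in> sets borel" for n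
    using conv \<open>open V\<close> by (simp_all add: converges_in_probability_def)
  obtain \<delta> where \<delta>: "\<delta> > 0" "\<And>x. dist x c < \<delta> \<Longrightarrow> x \<in> V"
    using assms(2,3) unfolding open_dist by blast
  have "(\<lambda>n. prob {\<omega>\<in>space M. Z n \<omega> \<notin> V}) \<longlonglongrightarrow> 0"
  proof (rule prob_tendsto_0_mono)
    show "(\<lambda>n. prob {\<omega>\<in>space M. \<delta> \<le> dist (Z n \<omega>) c}) \<longlonglongrightarrow> 0"
      using conv \<delta>(1) by (simp add: converges_in_probability_def)
    show "\<forall>\<^sub>F n in sequentially. \<forall>\<omega>\<in>space M. Z n \<omega> \<notin> V \<longrightarrow> \<delta> \<le> dist (Z n \<omega>) c"
      using \<delta>(2) by (intro always_eventually) (force simp: not_less[symmetric])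
  qed measurable
  then have "(\<lambda>n. 1 - prob {\<omega>\<in>space M. Z n \<omega> \<notin> V}) \<longlonglongrightarrow> 1 - 0"
    by (intro tendsto_intros)
  moreover have "1 - prob {\<omega>\<in>space M. Z n \<omega> \<notin> V} = prob {\<omega>\<in>space M. Z n \<omega> \<in> V}" for n
    using prob_neg[of "\<lambda>\<omega>. Z n \<omega> \<in> V"] by simp
  ultimately show ?thesis by simp
qed

context
  fixes X :: "'a \<Rightarrow> real"
  assumes X_meas [measurable]: "X \<in> borel_measurable M"
    and X_nonconst: "\<not> (\<exists>c. AE \<omega> in M. X \<omega> = c)"
begin

text \<open>The inverse of \<open>K_X'\<close>. It is global, because \<open>K_X'\<close> is strictly increasing.\<close>

definition tilt_of_mean :: "real \<Rightarrow> real" where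
  "tilt_of_mean = the_inv_into {s. mgf_exists M X s} (tilted_mean X)"

lemma inj_on_tilted_mean: "inj_on (tilted_mean X) {s. mgf_exists M X s}"
  using strict_mono_on_tilted_mean[OF X_meas X_nonconst] by (rule strict_mono_on_imp_inj_on)

lemma open_tilted_mean_image: "open (tilted_mean X ` {s. mgf_exists M X s})"
  by (rule invariance_of_domain[OF continuous_on_tilted_mean[OF X_meas] open_mgf_exists inj_on_tilted_mean])

lemma tilt_of_mean_tilted_mean: "mgf_exists M X s \<Longrightarrow> tilt_of_mean (tilted_mean X s) = s"
  unfolding tilt_of_mean_def by (rule the_inv_into_f_f[OF inj_on_tilted_mean]) simp

lemma has_real_derivative_tilt_of_mean:
  assumes "mgf_exists M X s"
  shows "(tilt_of_mean has_real_derivative inverse (tilted_variance X s)) (at (tilted_mean X s))"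
  unfolding has_field_derivative_def
proof (rule has_derivative_inverse_strong[OF open_mgf_exists _ continuous_on_tilted_mean[OF X_meas]])
  show "(tilted_mean X has_derivative (*) (tilted_variance X s)) (at s)"
    using has_real_derivative_tilted_mean[OF X_meas assms] by (simp add: has_field_derivative_def)
  have "tilted_variance X s \<noteq> 0" using tilted_variance_eq_0_iff[OF X_meas assms] X_nonconst by simp
  then show "(*) (tilted_variance X s) \<circ> (*) (inverse (tilted_variance X s)) = id"
    by (simp add: fun_eq_iff)
qed (use assms tilt_of_mean_tilted_mean in auto)

context
  fixes U :: "'a \<Rightarrow> real"
  assumes U_meas [measurable]: "U \<in> borel_measurable M"
begin

abbreviation (input) observed :: "'a \<Rightarrow> real" where "observed \<equiv> \<lambda>\<omega>. X \<omega> + U \<omega>"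

text \<open>The slopes at which the correction system can be solved. As the condition is exact, the
  corrected estimator is known off this set as well: there it is a constant.\<close>

definition correctable_slopes :: "real set" where
  "correctable_slopes = {t. mgf_exists M observed t \<and>
     tilted_mean observed t - expectation U \<in> tilted_mean X ` {s. mgf_exists M X s}}"

definition corrected_slope :: "real \<Rightarrow> real" where
  "corrected_slope t = tilt_of_mean (tilted_mean observed t - expectation U)"

lemma observed_meas [measurable]: "observed \<in> borel_measurable M"
  by measurable

lemma G_fun_eq:
  assumes "mgf_exists M X s" "mgf_exists M observed t"
  shows "G_fun M X U s t = tilted_mean observed t - expectation U - tilted_mean X s"
  using assms by (simp add: G_fun_def deriv_cgf)

lemma corrected_slope_eq:
  assumes "tilted_mean observed t = tilted_mean X s + expectation U" "mgf_exists M X s"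
  shows "corrected_slope t = s"
  using assms by (simp add: corrected_slope_def tilt_of_mean_tilted_mean)

lemma correctable_slopesE:
  assumes "t \<in> correctable_slopes"
  obtains "mgf_exists M observed t" "mgf_exists M X (corrected_slope t)"
    "tilted_mean X (corrected_slope t) = tilted_mean observed t - expectation U"
proof -
  from assms obtain s where s: "mgf_exists M observed t" "mgf_exists M X s"
      "tilted_mean observed t - expectation U = tilted_mean X s"
    unfolding correctable_slopes_def by blast
  then have "corrected_slope t = s" by (intro corrected_slope_eq) simp_all
  then show thesis using s that by simp
qed

lemma G_fun_zero_iff:
  assumes "mgf_exists M X s" "mgf_exists M observed t"
  shows "G_fun M X U s t = 0 \<longleftrightarrow> t \<in> correctable_slopes \<and> s = corrected_slope t"
proof
  assume "G_fun M X U s t = 0"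
  then have eq: "tilted_mean observed t = tilted_mean X s + expectation U"
    using G_fun_eq[OF assms] by simp
  then have "corrected_slope t = s" using assms(1) by (rule corrected_slope_eq)
  moreover have "t \<in> correctable_slopes"
    using eq assms by (auto simp: correctable_slopes_def)
  ultimately show "t \<in> correctable_slopes \<and> s = corrected_slope t" by simp
next
  assume t: "t \<in> correctable_slopes \<and> s = corrected_slope t"
  then have "tilted_mean X s = tilted_mean observed t - expectation U"
    by (blast elim: correctable_slopesE)
  then show "G_fun M X U s t = 0"
    using G_fun_eq[OF assms] by simp
qed

lemma open_correctable_slopes: "open correctable_slopes"
proof -
  have "correctable_slopes = {t. mgf_exists M observed t} \<inter>
      (\<lambda>t. tilted_mean observed t - expectation U) -` (tilted_mean X ` {s. mgf_exists M X s})"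
    by (auto simp: correctable_slopes_def)
  also have "open \<dots>"
    by (intro continuous_open_preimage continuous_on_diff continuous_on_tilted_mean[OF observed_meas]
        continuous_on_const open_mgf_exists open_tilted_mean_image)
  finally show ?thesis .
qed

lemma has_real_derivative_corrected_slope:
  assumes "t \<in> correctable_slopes"
  shows "(corrected_slope has_real_derivative
    tilted_variance observed t / tilted_variance X (corrected_slope t)) (at t)"
proof -
  obtain ex: "mgf_exists M observed t" "mgf_exists M X (corrected_slope t)"
    and eq: "tilted_mean X (corrected_slope t) = tilted_mean observed t - expectation U"
    using correctable_slopesE[OF assms] .
  have "((\<lambda>t. tilted_mean observed t - expectation U) has_real_derivative tilted_variance observed t) (at t)"
    using has_real_derivative_tilted_mean[OF observed_meas ex(1)] by (auto intro!: derivative_eq_intros)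
  moreover have "(tilt_of_mean has_real_derivative inverse (tilted_variance X (corrected_slope t)))
      (at (tilted_mean observed t - expectation U))"
    using has_real_derivative_tilt_of_mean[OF ex(2)] by (simp add: eq)
  ultimately have "((\<lambda>t. tilt_of_mean (tilted_mean observed t - expectation U)) has_real_derivative
      inverse (tilted_variance X (corrected_slope t)) * tilted_variance observed t) (at t)"
    by (rule DERIV_chain2[rotated])
  then show ?thesis
    by (simp add: corrected_slope_def[abs_def] divide_inverse mult.commute)
qed

lemma continuous_on_corrected_slope: "continuous_on correctable_slopes corrected_slope"
  using has_real_derivative_corrected_slope
  by (intro continuous_at_imp_continuous_on ballI) (blast intro: DERIV_isCont)

lemma C1_corrected_slope: "corrected_slope C1_differentiable_on correctable_slopes"
  unfolding C1_differentiable_on_def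
proof (intro exI conjI ballI)
  show "(corrected_slope has_vector_derivative
      tilted_variance observed t / tilted_variance X (corrected_slope t)) (at t)"
    if "t \<in> correctable_slopes" for t
    using has_real_derivative_corrected_slope[OF that] by (simp add: has_real_derivative_iff_has_vector_derivative)
  have sub: "correctable_slopes \<subseteq> {t. mgf_exists M observed t}"
    "corrected_slope ` correctable_slopes \<subseteq> {s. mgf_exists M X s}"
    by (auto elim: correctable_slopesE)
  have "tilted_variance X (corrected_slope t) \<noteq> 0" if "t \<in> correctable_slopes" for t
    using tilted_variance_eq_0_iff[OF X_meas] X_nonconst sub(2) that by blast
  then show "continuous_on correctable_slopes
      (\<lambda>t. tilted_variance observed t / tilted_variance X (corrected_slope t))"
    by (intro continuous_on_divide continuous_on_subset[OF continuous_on_tilted_variance[OF observed_meas] sub(1)]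
        continuous_on_compose2[OF continuous_on_tilted_variance[OF X_meas] continuous_on_corrected_slope sub(2)]) auto
qed

lemma correction_system_iff:
  "correction_system M X U b \<beta> \<longleftrightarrow> snd b \<in> correctable_slopes \<and>
    \<beta> = (fst b + ln (mgf M observed (snd b) / mgf M X (corrected_slope (snd b))), corrected_slope (snd b))"
proof
  assume sys: "correction_system M X U b \<beta>"
  then have "snd b \<in> correctable_slopes \<and> snd \<beta> = corrected_slope (snd b)"
    by (intro G_fun_zero_iff[THEN iffD1]) (simp_all only: correction_system_def)
  then show "snd b \<in> correctable_slopes \<and>
    \<beta> = (fst b + ln (mgf M observed (snd b) / mgf M X (corrected_slope (snd b))), corrected_slope (snd b))"
    using sys by (simp only: correction_system_def prod_eq_iff fst_conv snd_conv simp_thms)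
next
  assume \<beta>: "snd b \<in> correctable_slopes \<and>
    \<beta> = (fst b + ln (mgf M observed (snd b) / mgf M X (corrected_slope (snd b))), corrected_slope (snd b))"
  then have T: "snd b \<in> correctable_slopes" by blast
  have ex: "mgf_exists M observed (snd b)" "mgf_exists M X (corrected_slope (snd b))"
    by (rule correctable_slopesE[OF T], assumption)+
  have "G_fun M X U (corrected_slope (snd b)) (snd b) = 0"
    using G_fun_zero_iff[OF ex(2,1)] T by blast
  then show "correction_system M X U b \<beta>"
    using ex \<beta> by (simp only: correction_system_def fst_conv snd_conv simp_thms)
qed

lemma corrected_eq:
  "corrected M X U b = (if snd b \<in> correctable_slopes
     then (fst b + ln (mgf M observed (snd b) / mgf M X (corrected_slope (snd b))), corrected_slope (snd b))
     else (THE \<beta>. False))"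
proof -
  define c where "c = (fst b + ln (mgf M observed (snd b) / mgf M X (corrected_slope (snd b))), corrected_slope (snd b))"
  have "correction_system M X U b = (\<lambda>\<beta>. snd b \<in> correctable_slopes \<and> \<beta> = c)"
    unfolding c_def by (rule ext, rule correction_system_iff)
  then show ?thesis
    unfolding corrected_def c_def[symmetric] by (cases "snd b \<in> correctable_slopes") simp_all
qed

lemma continuous_on_corrected: "continuous_on {b. snd b \<in> correctable_slopes} (corrected M X U)"
proof -
  let ?D = "{b :: real \<times> real. snd b \<in> correctable_slopes}"
  have sub: "snd ` ?D \<subseteq> {t. mgf_exists M observed t}" "(\<lambda>b. corrected_slope (snd b)) ` ?D \<subseteq> {s. mgf_exists M X s}"
    by (auto elim: correctable_slopesE)
  have slope: "continuous_on ?D (\<lambda>b. corrected_slope (snd b))"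
    by (rule continuous_on_compose2[OF continuous_on_corrected_slope continuous_on_snd]) (auto intro: continuous_on_id)
  have "mgf M observed (snd b) \<noteq> 0" "mgf M X (corrected_slope (snd b)) \<noteq> 0" if "b \<in> ?D" for b
    using mgf_pos[of observed "snd b"] mgf_pos[of X "corrected_slope (snd b)"] sub that by fastforce+
  then have "continuous_on ?D
      (\<lambda>b. (fst b + ln (mgf M observed (snd b) / mgf M X (corrected_slope (snd b))), corrected_slope (snd b)))"
    by (intro continuous_intros slope
        continuous_on_compose2[OF continuous_on_mgf[OF observed_meas] _ sub(1)]
        continuous_on_compose2[OF continuous_on_mgf[OF X_meas] slope sub(2)]) auto
  then show ?thesis by (rule continuous_on_eq) (simp add: corrected_eq)
qed

lemma open_correctable: "open {b :: real \<times> real. snd b \<in> correctable_slopes}"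
  using open_vimage[OF open_correctable_slopes, of "snd :: real \<times> real \<Rightarrow> real"]
  by (simp add: vimage_def continuous_on_snd continuous_on_id)

text \<open>Continuous on an open set and constant on its complement.\<close>

lemma borel_measurable_corrected: "corrected M X U \<in> borel_measurable borel"
proof -
  let ?D = "{b :: real \<times> real. snd b \<in> correctable_slopes}"
  have "(\<lambda>b. if b \<in> ?D then corrected M X U b else (THE \<beta>. False)) \<in> borel_measurable borel"
    by (intro borel_measurable_continuous_on_if continuous_on_corrected continuous_on_const
        borel_open open_correctable)
  also have "(\<lambda>b. if b \<in> ?D then corrected M X U b else (THE \<beta>. False)) = corrected M X U"
    by (rule ext) (simp add: corrected_eq)
  finally show ?thesis .
qed

lemma isCont_corrected: "snd b \<in> correctable_slopes \<Longrightarrow> isCont (corrected M X U) b"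
  using continuous_on_corrected continuous_on_eq_continuous_at[OF open_correctable] by blast

end
end
end

theorem theorem2:
  fixes M :: "'a measure"
    and X Y U W :: "'a \<Rightarrow> real"
    and Xs Ys Us Ws :: "nat \<Rightarrow> 'a \<Rightarrow> real"
    and \<beta>0 \<beta>1 b0 b1 :: real
    and \<beta>N \<beta>CN :: "nat \<Rightarrow> 'a \<Rightarrow> real \<times> real"
  assumes "prob_space M"
    and "X \<in> borel_measurable M" "Y \<in> borel_measurable M" "U \<in> borel_measurable M"
    and "poisson_regression M X Y (\<beta>0, \<beta>1)"
    and W_def: "W = (\<lambda>\<omega>. X \<omega> + U \<omega>)"
    and "prob_space.indep_set M (sets (vimage_algebra (space M) U borel))
           (sets (vimage_algebra (space M) (\<lambda>\<omega>. (X \<omega>, Y \<omega>)) borel))"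
    and "integrable M U" "integrable M (\<lambda>\<omega>. (U \<omega>)\<^sup>2)"
    and iid: "prob_space.indep_vars M (\<lambda>_. borel) (\<lambda>i \<omega>. (Ys i \<omega>, Xs i \<omega>, Us i \<omega>)) UNIV"
      "\<And>i. distr M borel (\<lambda>\<omega>. (Ys i \<omega>, Xs i \<omega>, Us i \<omega>)) = distr M borel (\<lambda>\<omega>. (Y \<omega>, X \<omega>, U \<omega>))"
    and Ws_def: "Ws = (\<lambda>i \<omega>. Xs i \<omega> + Us i \<omega>)"
    and "naive_estimator M Ys Ws \<beta>N"
    and "limiting_equation M Y W (b0, b1)"
    and "mgf_exists M X \<beta>1" "mgf_exists M X b1" "mgf_exists M U b1"
    and G_zero: "\<exists>s t. mgf_exists M X s \<and> mgf_exists M W t \<and> G_fun M X U s t = 0"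
    and G_deriv: "deriv (\<lambda>s. G_fun M X U s b1) \<beta>1 = - deriv (deriv (cgf M X)) \<beta>1"
      "- deriv (deriv (cgf M X)) \<beta>1 \<noteq> 0"
    and \<beta>CN_def: "\<beta>CN = (\<lambda>n \<omega>. corrected M X U (\<beta>N n \<omega>))"
  shows "(\<exists>h S T. open S \<and> \<beta>1 \<in> S \<and> (\<forall>s\<in>S. mgf_exists M X s) \<and>
            open T \<and> b1 \<in> T \<and> (\<forall>t\<in>T. mgf_exists M W t) \<and>
            h C1_differentiable_on T \<and> h \<in> T \<rightarrow> S \<and> h b1 = \<beta>1 \<and>
            (\<forall>s\<in>S. \<forall>t\<in>T. G_fun M X U s t = 0 \<longleftrightarrow> s = h t) \<and>
            (\<forall>n. \<forall>\<omega>\<in>space M. snd (\<beta>N n \<omega>) \<in> T \<longrightarrow>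
               fst (\<beta>CN n \<omega>) =
                 fst (\<beta>N n \<omega>) + ln (mgf M W (snd (\<beta>N n \<omega>)) / mgf M X (snd (\<beta>CN n \<omega>))) \<and>
               snd (\<beta>CN n \<omega>) = h (snd (\<beta>N n \<omega>))) \<and>
            (\<lambda>n. measure M {\<omega>\<in>space M. snd (\<beta>N n \<omega>) \<in> T}) \<longlonglongrightarrow> 1)
         \<and> converges_in_probability M \<beta>CN (\<beta>0, \<beta>1)"
proof -
  interpret prob_space M by fact
  note [measurable] = \<open>X \<in> borel_measurable M\<close> \<open>Y \<in> borel_measurable M\<close> \<open>U \<in> borel_measurable M\<close>
  have [measurable]: "fst \<in> borel_measurable (borel :: (real \<times> real) measure)"
    "snd \<in> borel_measurable (borel :: (real \<times> real) measure)"
    by (intro borel_measurable_continuous_onI continuous_intros)+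
  have indep_UX: "indep_var borel U borel X" and indep_UY: "indep_var borel U borel Y"
    using indep_var_of_indep_vimage_algebras[OF _ _ _ assms(7), of fst]
      indep_var_of_indep_vimage_algebras[OF _ _ _ assms(7), of snd] by simp_all
  have indep_XU: "indep_var borel X borel U"
    using indep_UX by (rule indep_var_swap)
  have "tilted_variance X \<beta>1 \<noteq> 0"
    using G_deriv(2) has_real_derivative_deriv_cgf[OF assms(2,15)] by (auto dest: DERIV_imp_deriv)
  then have X_nonconst: "\<not> (\<exists>c. AE \<omega> in M. X \<omega> = c)"
    using tilted_variance_eq_0_iff[OF assms(2,15)] by blast
  have exW: "mgf_exists M (\<lambda>\<omega>. X \<omega> + U \<omega>) b1"
    by (rule mgf_exists_add_indep[OF indep_XU assms(16,17)])
  have W_nonconst: "\<not> (\<exists>c. AE \<omega> in M. X \<omega> + U \<omega> = c)"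
    by (rule not_AE_const_add_indep[OF indep_XU assms(16,17) X_nonconst])
  let ?T = "correctable_slopes X U" and ?h = "corrected_slope X U"
  have ident: "exp \<beta>0 * mgf M X \<beta>1 = exp b0 * mgf M W b1"
    "tilted_mean W b1 = tilted_mean X \<beta>1 + expectation U"
    using poisson_regression_identification[OF assms(2,3,5) _ assms(8) indep_UY, of "(b0, b1)"] assms(14,15) exW
    by (simp_all add: W_def)
  have slope: "?h b1 = \<beta>1"
    using ident(2) assms(4,15) unfolding W_def
    by (intro corrected_slope_eq[OF assms(2) X_nonconst])
  have b1: "b1 \<in> ?T"
    using ident(2) assms(15) exW by (auto simp: correctable_slopes_def[OF assms(2) X_nonconst assms(4)] W_def)
  have "\<beta>0 = b0 + ln (mgf M W b1 / mgf M X \<beta>1)"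
  proof -
    have pos: "mgf M W b1 / mgf M X \<beta>1 > 0"
      using mgf_pos[OF assms(15)] mgf_pos[OF exW] by (simp add: W_def)
    have "exp \<beta>0 = exp b0 * (mgf M W b1 / mgf M X \<beta>1)"
      using ident(1) mgf_pos[OF assms(15)] by (simp add: field_simps)
    also have "\<dots> = exp (b0 + ln (mgf M W b1 / mgf M X \<beta>1))"
      using pos by (simp add: exp_add)
    finally show ?thesis by (simp only: exp_inj_iff)
  qed
  then have corrected_b: "corrected M X U (b0, b1) = (\<beta>0, \<beta>1)"
    using b1 slope by (simp add: corrected_eq[OF assms(2) X_nonconst assms(4)] W_def)
  have consistent: "converges_in_probability M \<beta>N (b0, b1)"
  proof (rule naive_estimator_consistent[where Y = Y and W = W and Ys = Ys and Ws = Ws])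
    define g :: "real \<times> real \<times> real \<Rightarrow> real \<times> real" where "g = (\<lambda>(y, x, u). (y, x + u))"
    have g_meas: "g \<in> borel_measurable borel"
      unfolding g_def case_prod_beta by (intro borel_measurable_continuous_onI continuous_intros)
    have "indep_vars (\<lambda>_. borel) (\<lambda>i \<omega>. g (Ys i \<omega>, Xs i \<omega>, Us i \<omega>)) UNIV"
      by (rule indep_vars_compose2[OF iid(1)]) (rule g_meas)
    then show "indep_vars (\<lambda>_. borel) (\<lambda>i \<omega>. (Ys i \<omega>, Ws i \<omega>)) UNIV"
      by (simp add: g_def Ws_def)
    have meas: "(\<lambda>\<omega>. (Ys i \<omega>, Xs i \<omega>, Us i \<omega>)) \<in> borel_measurable M" for i
      using iid(1) by (simp add: indep_vars_def)
    have "distr M borel (\<lambda>\<omega>. g (Ys i \<omega>, Xs i \<omega>, Us i \<omega>))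
        = distr (distr M borel (\<lambda>\<omega>. (Ys i \<omega>, Xs i \<omega>, Us i \<omega>))) borel g" for i
      by (simp only: distr_distr[OF g_meas meas] o_def)
    moreover have "distr M borel (\<lambda>\<omega>. g (Y \<omega>, X \<omega>, U \<omega>)) = distr (distr M borel (\<lambda>\<omega>. (Y \<omega>, X \<omega>, U \<omega>))) borel g"
      by (subst distr_distr[OF g_meas]) (simp_all add: o_def)
    ultimately have "distr M borel (\<lambda>\<omega>. g (Ys i \<omega>, Xs i \<omega>, Us i \<omega>)) = distr M borel (\<lambda>\<omega>. g (Y \<omega>, X \<omega>, U \<omega>))" for i
      by (simp only: iid(2))
    then show "distr M borel (\<lambda>\<omega>. (Ys i \<omega>, Ws i \<omega>)) = distr M borel (\<lambda>\<omega>. (Y \<omega>, W \<omega>))" for i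
      by (simp add: g_def Ws_def W_def)
    show "W \<in> borel_measurable M" unfolding W_def by measurable
    show "mgf_exists M W (snd (b0, b1))" using exW by (simp only: W_def snd_conv)
    show "\<not> (\<exists>c. AE \<omega> in M. W \<omega> = c)" using W_nonconst by (simp only: W_def not_False_eq_True)
  qed fact+
  have "(\<lambda>n. prob {\<omega>\<in>space M. \<beta>N n \<omega> \<in> {c. snd c \<in> ?T}}) \<longlonglongrightarrow> 1"
    using b1 by (intro converges_in_probability_imp_prob_open[OF consistent]
        open_correctable[OF assms(2) X_nonconst assms(4)]) simp
  then have prob_T: "(\<lambda>n. prob {\<omega>\<in>space M. snd (\<beta>N n \<omega>) \<in> ?T}) \<longlonglongrightarrow> 1" by simp
  have \<beta>CN_consistent: "converges_in_probability M \<beta>CN (\<beta>0, \<beta>1)"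
    using converges_in_probability_continuous_image[OF consistent
        borel_measurable_corrected[OF assms(2) X_nonconst assms(4)]
        isCont_corrected[OF assms(2) X_nonconst assms(4)]] b1
    by (simp add: corrected_b \<beta>CN_def)
  have T_ex: "mgf_exists M W t" "mgf_exists M X (?h t)" if "t \<in> ?T" for t
    using correctable_slopesE[OF assms(2) X_nonconst assms(4) that] by (auto simp: W_def)
  have zeros: "\<forall>s\<in>{s. mgf_exists M X s}. \<forall>t\<in>?T. G_fun M X U s t = 0 \<longleftrightarrow> s = ?h t"
    using G_fun_zero_iff[OF assms(2) X_nonconst assms(4)] T_ex(1) by (auto simp: W_def)
  have formula: "fst (\<beta>CN n \<omega>) =
                 fst (\<beta>N n \<omega>) + ln (mgf M W (snd (\<beta>N n \<omega>)) / mgf M X (snd (\<beta>CN n \<omega>))) \<and>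
               snd (\<beta>CN n \<omega>) = ?h (snd (\<beta>N n \<omega>))" if "snd (\<beta>N n \<omega>) \<in> ?T" for n \<omega>
    using that by (simp add: \<beta>CN_def corrected_eq[OF assms(2) X_nonconst assms(4)] W_def)
  show ?thesis
  proof (rule conjI[OF exI[of _ ?h, OF exI[of _ "{s. mgf_exists M X s}", OF exI[of _ ?T]]] \<beta>CN_consistent], intro conjI)
    show "open {s. mgf_exists M X s}" by (rule open_mgf_exists)
    show "open ?T" by (rule open_correctable_slopes[OF assms(2) X_nonconst assms(4)])
    show "?h C1_differentiable_on ?T" by (rule C1_corrected_slope[OF assms(2) X_nonconst assms(4)])
    show "\<forall>t\<in>?T. mgf_exists M W t" "?h \<in> ?T \<rightarrow> {s. mgf_exists M X s}" using T_ex by blast+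
    show "\<forall>n. \<forall>\<omega>\<in>space M. snd (\<beta>N n \<omega>) \<in> ?T \<longrightarrow>
               fst (\<beta>CN n \<omega>) =
                 fst (\<beta>N n \<omega>) + ln (mgf M W (snd (\<beta>N n \<omega>)) / mgf M X (snd (\<beta>CN n \<omega>))) \<and>
               snd (\<beta>CN n \<omega>) = ?h (snd (\<beta>N n \<omega>))" by (intro allI ballI impI formula)
    show "\<beta>1 \<in> {s. mgf_exists M X s}" "\<forall>s\<in>{s. mgf_exists M X s}. mgf_exists M X s" using assms(15) by blast+
  qed (fact b1 slope prob_T zeros)+
qed

end
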